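(* Let $(\mathbb{L},\mu)$ be a random iterated function system of contracting similarities on $\mathbb{R}^d$ that satisfies the uniform open set condition, the uniform bounds $2\le\sup_\lambda\mathcal{N}_\lambda<\infty$ and $0<c_{\min}\le c_\lambda^i\le c_{\max}<1$ for all $\lambda,i$, and $\mathbb{E}(\log\mathcal{N}_{\omega_1})>0$. Assume it is equicontractive, i.e. for every $\lambda\in\Lambda$ there is $c_\lambda$ with $c_\lambda^i=c_\lambda$ for all $1\le i\le\mathcal{N}_\lambda$, and that it is not almost deterministic. Let $F_\omega$ be the associated random homogeneous attractor and let $h$ be a gauge function. Then for almost all $\omega\in\Omega$, \[ \mathscr{H}^h(F_\omega)\in\{0,\infty\}. \] In particular, there exists no gauge function $h$ such that $0<\mathscr{H}^h(F_\omega)<\infty$ almost surely.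
   Context: **Random iterated function system (RIFS).** $\Lambda\subset\mathbb{R}^k$ is a non-empty compact set with a Borel probability measure $\mu$. For each $\lambda\in\Lambda$, $\mathbb{I}_\lambda=\{f_\lambda^1,\dots,f_\lambda^{\mathcal{N}_\lambda}\}$, $\mathcal{N}_\lambda\in\mathbb{N}$, $\mathcal{N}_\lambda\ge1$, is a finite family of maps of $\mathbb{R}^d$ with $|f_\lambda^i(x)-f_\lambda^i(y)|=c_\lambda^i|x-y|$, $c_\lambda^i\in(0,1)$. Put $\mathbb{L}=\{\mathbb{I}_\lambda\}_{\lambda\in\Lambda}$; the pair $(\mathbb{L},\mu)$ is the RIFS. The dependence on $\lambda$ is understood to be measurable, and there is a compact $\Delta\subset\mathbb{R}^d$ with $f_\lambda^i(\Delta)\subseteq\Delta$ for all $\lambda,i$. **UOSC.** There is a non-empty bounded open set $\mathcal{O}\subset\mathbb{R}^d$ with $f_\lambda^i(\mathcal{O})\subseteq\mathcal{O}$ and $f_\lambda^i(\mathcal{O})\cap f_\lambda^j(\mathcal{O})=\varnothing$ for all $\lambda\in\Lambda$, $1\le i\neq j\le\mathcal{N}_\lambda$. **Random homogeneous attractor.** $\Omega=\Lambda^{\mathbb{N}}$ with the product measure $\mathbb{P}_H=\mu^{\mathbb{N}}$; "almost all/surely" and $\mathbb{E}$ refer to $\mathbb{P}_H$. For $\omega=\omega_1\omega_2\cdots\in\Omega$, \[F_\omega=\bigcap_{k=1}^\infty\ \bigcup_{1\le j_i\le\mathcal{N}_{\omega_i},\,1\le i\le k} f_{\omega_1}^{j_1}\circ\cdots\circ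 f_{\omega_k}^{j_k}(\Delta).\] **Almost deterministic.** $(\mathbb{L},\mu)$ is almost deterministic if there is $s$ with $\sum_{j=1}^{\mathcal{N}_\lambda}(c_\lambda^j)^s=1$ for $\mu$-almost every $\lambda$. **Gauge functions.** A gauge function is a left-continuous, non-decreasing $h:[0,\infty)\to[0,\infty)$ with $h(r)\to0$ as $r\to0$. $\mathscr{H}^h(F)=\lim_{\delta\to0}\inf\{\sum_i h(|U_i|) : \{U_i\}$ a countable cover of $F$ by sets of diameter $|U_i|\le\delta\}$. *)

theory Defs
  imports "HOL-Probability.Probability"
begin

section \<open>Gauge functions and Hausdorff measures\<close>

text \<open>
  A gauge function has domain \<open>[0,\<infinity>)\<close>; its values at negative arguments are irrelevant. The
  conditions force \<open>h 0 = 0\<close>, and left-continuity says nothing at \<open>0\<close>.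
\<close>

definition gauge_function :: "(real \<Rightarrow> real) \<Rightarrow> bool" where
  "gauge_function h \<longleftrightarrow>
     (\<forall>r\<ge>0. 0 \<le> h r) \<and>
     mono_on {0..} h \<and>
     (\<forall>r>0. continuous (at_left r) h) \<and>
     (h \<longlongrightarrow> 0) (at_right 0)"

text \<open>
  Covers are indexed by \<^typ>\<open>nat\<close>; a finite cover is padded with empty sets, which cost \<open>h 0 = 0\<close>.
  Boundedness is required explicitly because \<^const>\<open>diameter\<close> is real-valued and carries no
  information for unbounded sets.
\<close>

definition hausdorff_pre :: "(real \<Rightarrow> real) \<Rightarrow> real \<Rightarrow> 'a::metric_space set \<Rightarrow> ennreal" where
  "hausdorff_pre h \<delta> F =
     (INF U \<in> {U :: nat \<Rightarrow> 'a set.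
                 (\<forall>i. bounded (U i) \<and> diameter (U i) \<le> \<delta>) \<and> F \<subseteq> (\<Union>i. U i)}.
        \<Sum>i. ennreal (h (diameter (U i))))"

definition hausdorff_measure :: "(real \<Rightarrow> real) \<Rightarrow> 'a::metric_space set \<Rightarrow> ennreal" where
  "hausdorff_measure h F = Lim (at_right 0) (\<lambda>\<delta>. hausdorff_pre h \<delta> F)"

lemma hausdorff_pre_antimono: "\<delta> \<le> \<delta>' \<Longrightarrow> hausdorff_pre h \<delta>' F \<le> hausdorff_pre h \<delta> F"
  unfolding hausdorff_pre_def by (rule INF_superset_mono) (auto intro: order_trans)

text \<open>The limit in the definition exists, so \<^const>\<open>Lim\<close> is meaningful.\<close>

lemma hausdorff_pre_tendsto_SUP:
  "((\<lambda>\<delta>. hausdorff_pre h \<delta> F) \<longlongrightarrow> (SUP \<delta>\<in>{0<..}. hausdorff_pre h \<delta> F)) (at_right 0)"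
proof (rule order_tendstoI)
  fix a assume "a < (SUP \<delta>\<in>{0<..}. hausdorff_pre h \<delta> F)"
  then obtain d where d: "d > 0" "a < hausdorff_pre h d F"
    by (auto simp: less_SUP_iff)
  have "eventually (\<lambda>\<delta>. \<delta> \<in> {0<..<d}) (at_right 0)"
    using d(1) by (rule eventually_at_right_real)
  then show "eventually (\<lambda>\<delta>. a < hausdorff_pre h \<delta> F) (at_right 0)"
  proof eventually_elim
    case (elim \<delta>)
    have "hausdorff_pre h d F \<le> hausdorff_pre h \<delta> F"
      by (rule hausdorff_pre_antimono) (use elim in simp)
    with d(2) show ?case by (rule less_le_trans)
  qed
next
  fix a assume a: "(SUP \<delta>\<in>{0<..}. hausdorff_pre h \<delta> F) < a"
  show "eventually (\<lambda>\<delta>. hausdorff_pre h \<delta> F < a) (at_right 0)"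
    using eventually_at_right_less[of "0::real"]
  proof eventually_elim
    case (elim \<delta>)
    have "hausdorff_pre h \<delta> F \<le> (SUP \<delta>\<in>{0<..}. hausdorff_pre h \<delta> F)"
      by (rule SUP_upper) (use elim in simp)
    then show ?case using a by (rule le_less_trans)
  qed
qed

lemma hausdorff_measure_eq_SUP:
  "hausdorff_measure h F = (SUP \<delta>\<in>{0<..}. hausdorff_pre h \<delta> F)"
  unfolding hausdorff_measure_def
  by (rule tendsto_Lim[OF _ hausdorff_pre_tendsto_SUP]) simp


section \<open>Random iterated function systems\<close>

text \<open>
  For \<open>l \<in> \<Lambda>\<close> the maps of the system are \<open>f l 1, \<dots>, f l (N l)\<close>, with contraction ratios
  \<open>c l 1, \<dots>, c l (N l)\<close>; values of \<open>f\<close> and \<open>c\<close> at other indices are irrelevant, so measurability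
  in the parameter is only required on \<open>{l \<in> \<Lambda>. i \<le> N l}\<close>.
\<close>

locale random_ifs = prob_space \<mu>
  for \<mu> :: "'l::euclidean_space measure" +
  fixes \<Lambda> :: "'l set"
    and N :: "'l \<Rightarrow> nat"
    and f :: "'l \<Rightarrow> nat \<Rightarrow> 'a::euclidean_space \<Rightarrow> 'a"
    and c :: "'l \<Rightarrow> nat \<Rightarrow> real"
    and \<Delta> :: "'a set"
  assumes compact_param: "compact \<Lambda>"
    and param_nonempty: "\<Lambda> \<noteq> {}"
    and space_param: "space \<mu> = \<Lambda>"
    and sets_param: "sets \<mu> = sets (restrict_space borel \<Lambda>)"
    and N_ge_1: "\<And>l. l \<in> \<Lambda> \<Longrightarrow> 1 \<le> N l"
    and similarity: "\<And>l i x y. l \<in> \<Lambda> \<Longrightarrow> i \<in> {1..N l} \<Longrightarrow>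
           dist (f l i x) (f l i y) = c l i * dist x y"
    and ratio: "\<And>l i. l \<in> \<Lambda> \<Longrightarrow> i \<in> {1..N l} \<Longrightarrow> 0 < c l i \<and> c l i < 1"
    and measurable_N: "N \<in> measurable \<mu> (count_space UNIV)"
    and measurable_f: "\<And>i x. 1 \<le> i \<Longrightarrow>
           (\<lambda>l. f l i x) \<in> borel_measurable (restrict_space \<mu> {l \<in> \<Lambda>. i \<le> N l})"
    and measurable_c: "\<And>i. 1 \<le> i \<Longrightarrow>
           (\<lambda>l. c l i) \<in> borel_measurable (restrict_space \<mu> {l \<in> \<Lambda>. i \<le> N l})"
    and compact_Delta: "compact \<Delta>"
    and invariant_Delta: "\<And>l i. l \<in> \<Lambda> \<Longrightarrow> i \<in> {1..N l} \<Longrightarrow> f l i ` \<Delta> \<subseteq> \<Delta>"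

definition uniform_osc ::
    "'l set \<Rightarrow> ('l \<Rightarrow> nat) \<Rightarrow> ('l \<Rightarrow> nat \<Rightarrow> 'a::metric_space \<Rightarrow> 'a) \<Rightarrow> bool" where
  "uniform_osc \<Lambda> N f \<longleftrightarrow>
     (\<exists>U. open U \<and> bounded U \<and> U \<noteq> {} \<and>
        (\<forall>l\<in>\<Lambda>. \<forall>i\<in>{1..N l}. f l i ` U \<subseteq> U) \<and>
        (\<forall>l\<in>\<Lambda>. \<forall>i\<in>{1..N l}. \<forall>j\<in>{1..N l}. i \<noteq> j \<longrightarrow> f l i ` U \<inter> f l j ` U = {}))"

definition equicontractive ::
    "'l set \<Rightarrow> ('l \<Rightarrow> nat) \<Rightarrow> ('l \<Rightarrow> nat \<Rightarrow> real) \<Rightarrow> bool" where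
  "equicontractive \<Lambda> N c \<longleftrightarrow> (\<forall>l\<in>\<Lambda>. \<exists>r. \<forall>i\<in>{1..N l}. c l i = r)"

definition almost_deterministic ::
    "'l measure \<Rightarrow> ('l \<Rightarrow> nat) \<Rightarrow> ('l \<Rightarrow> nat \<Rightarrow> real) \<Rightarrow> bool" where
  "almost_deterministic \<mu> N c \<longleftrightarrow>
     (\<exists>s::real. AE l in \<mu>. (\<Sum>j=1..N l. c l j powr s) = 1)"


section \<open>The random homogeneous attractor\<close>

text \<open>Sequences are indexed from \<open>0\<close>: the letter \<open>\<omega>\<^sub>i\<close> (\<open>i \<ge> 1\<close>) is \<open>\<omega> (i - 1)\<close>.\<close>

definition homogeneous_measure :: "'l measure \<Rightarrow> (nat \<Rightarrow> 'l) measure" where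
  "homogeneous_measure \<mu> = (\<Pi>\<^sub>M i\<in>UNIV. \<mu>)"

text \<open>\<open>f (\<omega> 0) (j 0) \<circ> \<dots> \<circ> f (\<omega> (k - 1)) (j (k - 1))\<close>\<close>

primrec composed_map ::
    "('l \<Rightarrow> nat \<Rightarrow> 'a \<Rightarrow> 'a) \<Rightarrow> (nat \<Rightarrow> 'l) \<Rightarrow> (nat \<Rightarrow> nat) \<Rightarrow> nat \<Rightarrow> 'a \<Rightarrow> 'a" where
  "composed_map f \<omega> j 0 = id"
| "composed_map f \<omega> j (Suc k) = composed_map f \<omega> j k \<circ> f (\<omega> k) (j k)"

definition homogeneous_attractor ::
    "('l \<Rightarrow> nat) \<Rightarrow> ('l \<Rightarrow> nat \<Rightarrow> 'a \<Rightarrow> 'a) \<Rightarrow> 'a set \<Rightarrow> (nat \<Rightarrow> 'l) \<Rightarrow> 'a set" where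
  "homogeneous_attractor N f \<Delta> \<omega> =
     (\<Inter>k\<in>{1..}. \<Union>j\<in>{j. \<forall>i<k. j i \<in> {1..N (\<omega> i)}}. composed_map f \<omega> j k ` \<Delta>)"

end

theory Submission
  imports Defs
begin

text \<open>
  Write \<open>P k\<close> and \<open>R k\<close> for the number and the contraction ratio of the words of length \<open>k\<close> and \<open>D\<close>
  for the diameter of \<open>\<Delta>\<close>. The cylinders of level \<open>k\<close> give an upper bound, and under the open set
  condition counting them gives a comparable lower bound, so that the Hausdorff measure is \<open>0\<close> or
  infinite according to \<open>L D := liminf (P k * h (D * R k))\<close>.

  By the Hewitt--Savage law \<open>L t\<close> is almost surely a constant \<open>B t\<close>, and \<open>B\<close> is monotone. Removing
  the first letter \<open>x\<close> gives \<open>B t = N x * B (t * c x)\<close> for almost every \<open>x\<close>. If the ratio of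
  \<open>ln (N x)\<close> to \<open>- ln (c x)\<close> is not almost surely constant, then one can choose a sequence of letters
  along which this ratio exceeds \<open>s'\<close> and another along which it is at most \<open>s < s'\<close>. Iterating the
  relation along both contradicts the monotonicity of \<open>B\<close>, unless \<open>B D\<close> is \<open>0\<close> or infinite.
\<close>

section \<open>The Hewitt--Savage zero-one law\<close>

lemma (in finite_measure) abs_measure_diff_le_sym_diff:
  assumes "A \<in> sets M" "B \<in> sets M"
  shows "\<bar>measure M A - measure M B\<bar> \<le> measure M (sym_diff A B)"
proof -
  have "measure M A \<le> measure M (B \<union> sym_diff A B)" "measure M B \<le> measure M (A \<union> sym_diff A B)"
    using assms by (auto intro!: finite_measure_mono)
  moreover have "measure M (B \<union> sym_diff A B) \<le> measure M B + measure M (sym_diff A B)"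
    "measure M (A \<union> sym_diff A B) \<le> measure M A + measure M (sym_diff A B)"
    using assms by (auto intro!: measure_Un_le)
  ultimately show ?thesis by linarith
qed

text \<open>The constant is the essential supremum: were \<open>d < f x\<close> not almost sure for
  some \<open>d\<close> below it, \<open>zero_one\<close> would give \<open>f x \<le> d\<close>
  almost surely, so \<open>d\<close> would bound the essential supremum. Testing \<open>d\<close> in
  a countable dense set suffices.\<close>

lemma (in prob_space) AE_eq_constI:
  fixes f :: "'a \<Rightarrow> 'b :: {complete_linorder, linorder_topology, second_countable_topology, dense_linorder}"
  assumes [measurable]: "f \<in> borel_measurable M"
    and zero_one: "\<And>z. (AE x in M. f x \<le> z) \<or> (AE x in M. z < f x)"
  shows "\<exists>z. AE x in M. f x = z"
proof -
  obtain D :: "'b set" where D: "countable D" "\<And>U. open U \<Longrightarrow> U \<noteq> {} \<Longrightarrow> \<exists>d\<in>D. d \<in> U"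
    using countable_dense_exists by blast
  have "AE x in M. \<forall>d\<in>D. d < esssup M f \<longrightarrow> d < f x"
  proof (subst AE_ball_countable[OF D(1)], intro ballI)
    fix d
    show "AE x in M. d < esssup M f \<longrightarrow> d < f x"
      using zero_one[of d]
    proof
      assume "AE x in M. f x \<le> d"
      from esssup_I[OF assms(1) this] show ?thesis by auto
    qed auto
  qed
  moreover have "AE x in M. f x \<le> esssup M f"
    by (rule esssup_AE)
  ultimately have "AE x in M. f x = esssup M f"
  proof eventually_elim
    case (elim x)
    show ?case
    proof (rule ccontr)
      assume "f x \<noteq> esssup M f"
      with elim(2) have "f x < esssup M f" by simp
      then have "\<exists>d\<in>D. d \<in> {f x<..<esssup M f}"
        by (intro D(2)) (auto simp: dense)
      then obtain d where "d \<in> D" "f x < d" "d < esssup M f" by auto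
      with elim(1) show False by auto
    qed
  qed
  then show ?thesis by blast
qed

context sequence_space
begin

lemma compose_in_space: "\<omega> \<in> space S \<Longrightarrow> \<omega> \<circ> \<pi> \<in> space S"
  by (simp add: space_PiM PiE_UNIV_domain Pi_iff)

text \<open>The events that cylinder events approximate in measure include the one-coordinate events
  and are closed under complements and countable unions. A cylinder event is encoded by its
  insensitivity to the coordinates from \<open>n\<close> on.\<close>

lemma approx_by_cylinder:
  assumes "A \<in> sets S" "e > 0"
  shows "\<exists>n. \<exists>B\<in>sets S. (\<forall>\<omega>\<in>space S. \<forall>\<omega>'\<in>space S. (\<forall>i<n. \<omega> i = \<omega>' i) \<longrightarrow> \<omega> \<in> B \<longrightarrow> \<omega>' \<in> B) \<and>
           measure S (sym_diff A B) < e"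
proof -
  define cyl where "cyl n B \<longleftrightarrow> B \<in> sets S \<and>
    (\<forall>\<omega>\<in>space S. \<forall>\<omega>'\<in>space S. (\<forall>i<n. \<omega> i = \<omega>' i) \<longrightarrow> \<omega> \<in> B \<longrightarrow> \<omega>' \<in> B)" for n :: nat and B
  have cyl_mono: "cyl m B" if "cyl n B" "n \<le> m" for n m B
    using that unfolding cyl_def by (meson less_le_trans)
  have "A \<in> sigma_sets (\<Pi>\<^sub>E i\<in>UNIV. space M)
      {{f\<in>\<Pi>\<^sub>E i\<in>UNIV. space M. f i \<in> A} | i A. i \<in> (UNIV :: nat set) \<and> A \<in> sets M}"
    using assms(1) by (simp only: sets_PiM_single)
  then have "\<forall>e>0. \<exists>n B. cyl n B \<and> measure S (sym_diff A B) < e"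
  proof (induction rule: sigma_sets.induct)
    case (Basic a)
    then obtain i X where a: "a = {f\<in>\<Pi>\<^sub>E i\<in>UNIV. space M. f i \<in> X}" "X \<in> sets M" by auto
    have "a = {\<omega>\<in>space S. \<omega> i \<in> X}"
      using a(1) by (auto simp: space_PiM)
    also have "\<dots> \<in> sets S"
      using a(2) by measurable
    finally have "cyl (Suc i) a"
      using a unfolding cyl_def by (auto simp: space_PiM)
    then show ?case by (intro allI impI exI[of _ "Suc i"] exI[of _ a]) simp
  next
    case Empty
    have "cyl 0 {}" by (simp add: cyl_def)
    then show ?case by (intro allI impI exI[of _ 0] exI[of _ "{}"]) simp
  next
    case (Compl a)
    show ?case
    proof (intro allI impI)
      fix e :: real assume "e > 0"
      with Compl.IH obtain n B where B: "cyl n B" "measure S (sym_diff a B) < e" by blast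
      have a: "a \<in> sets S" using Compl.hyps by (simp only: sets_PiM_single)
      have "cyl n (space S - B)"
        unfolding cyl_def
      proof (intro conjI ballI impI)
        fix \<omega> \<omega>' assume *: "\<omega> \<in> space S" "\<omega>' \<in> space S" "\<forall>i<n. \<omega> i = \<omega>' i" "\<omega> \<in> space S - B"
        then have "\<forall>i<n. \<omega>' i = \<omega> i" by simp
        with * B(1) show "\<omega>' \<in> space S - B" unfolding cyl_def by blast
      qed (use B(1) in \<open>auto simp: cyl_def\<close>)
      moreover have "sym_diff (space S - a) (space S - B) = sym_diff a B"
        using a B(1) sets.sets_into_space[of a S] sets.sets_into_space[of B S] unfolding cyl_def by blast
      ultimately show "\<exists>n B. cyl n B \<and> measure S (sym_diff ((UNIV \<rightarrow>\<^sub>E space M) - a) B) < e"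
        using B(2) by (intro exI[of _ n] exI[of _ "space S - B"]) (simp add: space_PiM)
    qed
  next
    case (Union a)
    show ?case
    proof (intro allI impI)
      fix e :: real assume e: "e > 0"
      have a: "a i \<in> sets S" for i
        using Union.hyps by (simp only: sets_PiM_single)
      let ?U = "\<lambda>n. \<Union>i<n. a i"
      have "(\<lambda>n. measure S (?U n)) \<longlonglongrightarrow> measure S (\<Union>n. ?U n)"
        using a by (intro P.finite_Lim_measure_incseq image_subsetI monoI UN_mono) auto
      moreover have "(\<Union>n. ?U n) = (\<Union>i. a i)" by auto
      ultimately have "\<forall>\<^sub>F n in sequentially. measure S (\<Union>i. a i) - e / 2 < measure S (?U n)"
        using e by (intro order_tendstoD) auto
      then obtain n where n: "measure S (\<Union>i. a i) - e / 2 < measure S (?U n)"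
        by (auto simp: eventually_sequentially)
      \<comment> \<open>Half of \<open>e\<close> pays for cutting the union at \<open>n\<close>, the
        other half is shared by the \<open>n\<close> remaining sets; \<open>Suc n\<close> avoids
        division by zero.\<close>
      have "\<forall>i. \<exists>m B. cyl m B \<and> measure S (sym_diff (a i) B) < e / (2 * real (Suc n))"
        using Union.IH e by simp
      then obtain m B where B: "\<And>i. cyl (m i) (B i)"
        "\<And>i. measure S (sym_diff (a i) (B i)) < e / (2 * real (Suc n))" by metis
      have BS: "B i \<in> sets S" for i using B(1) by (simp add: cyl_def)
      let ?V = "\<Union>i<n. B i"
      \<comment> \<open>The sum dominates each \<open>m i\<close> with \<open>i < n\<close>, so it
        is a common level for all \<open>B i\<close>.\<close>
      let ?k = "\<Sum>i<n. m i"
      have "cyl ?k (B i)" if "i < n" for i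
        using that by (intro cyl_mono[OF B(1)] member_le_sum) auto
      then have "cyl ?k ?V"
        using BS unfolding cyl_def by (intro conjI ballI impI sets.finite_UN) blast+
      moreover have "measure S (sym_diff (\<Union>i. a i) ?V) < e"
      proof -
        have "measure S (sym_diff (\<Union>i. a i) ?V)
            \<le> measure S (((\<Union>i. a i) - ?U n) \<union> (\<Union>i<n. sym_diff (a i) (B i)))"
          using a BS by (intro P.finite_measure_mono) auto
        also have "\<dots> \<le> measure S ((\<Union>i. a i) - ?U n) + measure S (\<Union>i<n. sym_diff (a i) (B i))"
          using a BS by (intro measure_Un_le) auto
        also have "measure S (\<Union>i<n. sym_diff (a i) (B i)) \<le> (\<Sum>i<n. measure S (sym_diff (a i) (B i)))"
          using a BS by (intro P.finite_measure_subadditive_finite) auto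
        also have "\<dots> \<le> (\<Sum>i<n. e / (2 * real (Suc n)))"
          by (intro sum_mono less_imp_le B(2))
        also have "\<dots> \<le> e / 2"
          using e by (simp add: field_simps)
        also have "measure S ((\<Union>i. a i) - ?U n) = measure S (\<Union>i. a i) - measure S (?U n)"
          using a by (intro P.finite_measure_Diff) auto
        finally show ?thesis using n by linarith
      qed
      ultimately show "\<exists>n B. cyl n B \<and> measure S (sym_diff (\<Union> (range a)) B) < e"
        by blast
    qed
  qed
  with \<open>e > 0\<close> obtain n B where "cyl n B" "measure S (sym_diff A B) < e" by blast
  then show ?thesis unfolding cyl_def by blast
qed

lemma distr_compose_inj:
  assumes "inj \<pi>"
  shows "distr S S (\<lambda>\<omega>. \<omega> \<circ> \<pi>) = S"
  using distr_PiM_reindex[of UNIV "\<lambda>_. M" \<pi> UNIV] assms prob_space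
  by (simp add: comp_def restrict_UNIV)

text \<open>The first \<open>n\<close> letters are independent of the later ones: \<open>S\<close>
  is the image of \<open>S \<Otimes>\<^sub>M S\<close> under \<open>comb_seq n\<close>, and the
  preimage of the event is \<open>B \<times> B\<close>.\<close>

lemma measure_block_and_shift:
  assumes B: "B \<in> sets S"
    and cyl: "\<And>\<omega> \<omega>'. \<omega> \<in> space S \<Longrightarrow> \<omega>' \<in> space S \<Longrightarrow> (\<forall>i<n. \<omega> i = \<omega>' i) \<Longrightarrow> \<omega> \<in> B \<Longrightarrow> \<omega>' \<in> B"
  shows "measure S {\<omega>\<in>space S. \<omega> \<in> B \<and> (\<lambda>i. \<omega> (n + i)) \<in> B} = (measure S B)\<^sup>2"
proof -
  let ?X = "{\<omega>\<in>space S. \<omega> \<in> B \<and> (\<lambda>i. \<omega> (n + i)) \<in> B}"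
  let ?c = "\<lambda>(\<omega>, \<omega>'). comb_seq n \<omega> \<omega>'"
  have "(\<lambda>\<omega>. (\<lambda>i. \<omega> (n + i))) \<in> measurable S S"
    by (intro measurable_PiM_single') (auto simp: space_PiM)
  with B have X: "?X \<in> sets S"
    by measurable
  have "emeasure S ?X = emeasure (distr (S \<Otimes>\<^sub>M S) S ?c) ?X"
    by (simp add: PiM_comb_seq)
  also have "\<dots> = emeasure (S \<Otimes>\<^sub>M S) (?c -` ?X \<inter> space (S \<Otimes>\<^sub>M S))"
    by (rule emeasure_distr[OF measurable_comb_seq X])
  also have "?c -` ?X \<inter> space (S \<Otimes>\<^sub>M S) = B \<times> B"
  proof -
    have "comb_seq n \<omega> \<omega>' \<in> space S" if "\<omega> \<in> space S" "\<omega>' \<in> space S" for \<omega> \<omega>'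
      using that by (auto simp: space_PiM comb_seq_def PiE_iff)
    moreover have "comb_seq n \<omega> \<omega>' \<in> B \<longleftrightarrow> \<omega> \<in> B" if "\<omega> \<in> space S" "\<omega>' \<in> space S" for \<omega> \<omega>'
      using that cyl[of \<omega> "comb_seq n \<omega> \<omega>'"] cyl[of "comb_seq n \<omega> \<omega>'" \<omega>] calculation[OF that]
      by (auto simp: comb_seq_def)
    moreover have "(\<lambda>i. comb_seq n \<omega> \<omega>' (n + i)) = \<omega>'" for \<omega> \<omega>' :: "nat \<Rightarrow> 'a"
      by (auto simp: comb_seq_def)
    ultimately show ?thesis
      using subsetD[OF sets.sets_into_space[OF B]] by (auto simp: space_pair_measure simp del: space_PiM)
  qed
  also have "emeasure (S \<Otimes>\<^sub>M S) (B \<times> B) = emeasure S B * emeasure S B"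
    by (rule P.emeasure_pair_measure_Times[OF B B])
  finally show ?thesis
    by (simp add: P.emeasure_eq_measure power2_eq_square flip: ennreal_mult)
qed

text \<open>Approximate \<open>A\<close> by an event \<open>B\<close> of the first \<open>n\<close>
  letters. Exchanging the first two blocks of length \<open>n\<close> fixes \<open>A\<close> and
  turns \<open>B\<close> into an independent copy \<open>B'\<close>. So the measure of
  \<open>A\<close> is close to that of \<open>B \<inter> B'\<close>, which is the square of that of
  \<open>B\<close>, and hence equals its own square.\<close>

theorem hewitt_savage_zero_one:
  assumes A: "A \<in> sets S"
    and exch: "\<And>\<pi> n \<omega>. \<pi> permutes {..<n} \<Longrightarrow> \<omega> \<in> space S \<Longrightarrow> \<omega> \<circ> \<pi> \<in> A \<longleftrightarrow> \<omega> \<in> A"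
  shows "measure S A = 0 \<or> measure S A = 1"
proof -
  let ?P = "measure S"
  have "\<bar>?P A - (?P A)\<^sup>2\<bar> \<le> e" if "e > 0" for e
  proof -
    \<comment> \<open>The two comparisons with the square of the measure of \<open>B\<close> cost
      \<open>2 * d\<close> each.\<close>
    define d where "d = e / 4"
    have d: "d > 0" using that by (simp add: d_def)
    obtain n B where B: "B \<in> sets S" "?P (sym_diff A B) < d"
      and "\<forall>\<omega>\<in>space S. \<forall>\<omega>'\<in>space S. (\<forall>i<n. \<omega> i = \<omega>' i) \<longrightarrow> \<omega> \<in> B \<longrightarrow> \<omega>' \<in> B"
      using approx_by_cylinder[OF A d] by (elim exE bexE conjE) (rule that)
    then have cyl: "\<omega>' \<in> B"
      if "\<omega> \<in> space S" "\<omega>' \<in> space S" "\<forall>i<n. \<omega> i = \<omega>' i" "\<omega> \<in> B" for \<omega> \<omega>'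
      using that by blast
    define \<pi> where "\<pi> i = (if i < n then n + i else if i < 2 * n then i - n else i)" for i
    have \<pi>: "\<pi> permutes {..<2 * n}"
    proof (rule bij_imp_permutes)
      show "bij_betw \<pi> {..<2 * n} {..<2 * n}"
        by (rule bij_betw_byWitness[where f' = \<pi>]) (auto simp: \<pi>_def)
    qed (auto simp: \<pi>_def)
    define B' where "B' = (\<lambda>\<omega>. \<omega> \<circ> \<pi>) -` B \<inter> space S"
    have meas: "(\<lambda>\<omega>. \<omega> \<circ> \<pi>) \<in> measurable S S"
      by (intro measurable_PiM_single') (auto simp: space_PiM)
    have B': "B' \<in> sets S"
      unfolding B'_def using meas B(1) by (rule measurable_sets)
    \<comment> \<open>Below \<open>n\<close> the sequence \<open>\<omega> \<circ> \<pi>\<close>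
      agrees with the shift of \<open>\<omega>\<close> by \<open>n\<close>, and \<open>B\<close>
      sees nothing else.\<close>
    have inB': "\<omega> \<in> B' \<longleftrightarrow> (\<lambda>i. \<omega> (n + i)) \<in> B" if "\<omega> \<in> space S" for \<omega>
    proof -
      have "\<omega> \<circ> \<pi> \<in> space S" "(\<lambda>i. \<omega> (n + i)) \<in> space S"
        using compose_in_space[OF that] by (simp_all add: comp_def)
      then show ?thesis
        using cyl[of "\<omega> \<circ> \<pi>" "\<lambda>i. \<omega> (n + i)"] cyl[of "\<lambda>i. \<omega> (n + i)" "\<omega> \<circ> \<pi>"] that
        by (auto simp: B'_def \<pi>_def)
    qed
    have "?P (sym_diff A B') = ?P ((\<lambda>\<omega>. \<omega> \<circ> \<pi>) -` sym_diff A B \<inter> space S)"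
      by (rule arg_cong[of _ _ ?P])
        (use exch[OF \<pi>] sets.sets_into_space[OF A] in \<open>auto simp: B'_def\<close>)
    also have "\<dots> = measure (distr S S (\<lambda>\<omega>. \<omega> \<circ> \<pi>)) (sym_diff A B)"
      by (rule measure_distr[symmetric, OF meas]) (use A B in auto)
    also have "\<dots> = ?P (sym_diff A B)"
      by (simp add: distr_compose_inj permutes_inj[OF \<pi>])
    finally have d': "?P (sym_diff A B') < d" using B(2) by simp
    have "B \<inter> B' = {\<omega>\<in>space S. \<omega> \<in> B \<and> (\<lambda>i. \<omega> (n + i)) \<in> B}"
      using sets.sets_into_space[OF B(1)] sets.sets_into_space[OF B'] inB' by auto
    then have sq: "?P (B \<inter> B') = (?P B)\<^sup>2"
      using measure_block_and_shift[OF B(1) cyl] by simp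
    have "\<bar>?P A - ?P (B \<inter> B')\<bar> \<le> ?P (sym_diff A (B \<inter> B'))"
      using A B B' by (intro P.abs_measure_diff_le_sym_diff) auto
    also have "\<dots> \<le> ?P (sym_diff A B \<union> sym_diff A B')"
      using A B B' by (intro P.finite_measure_mono) auto
    also have "\<dots> \<le> ?P (sym_diff A B) + ?P (sym_diff A B')"
      using A B B' by (intro measure_Un_le) auto
    finally have 1: "\<bar>?P A - (?P B)\<^sup>2\<bar> \<le> 2 * d"
      using d' B(2) sq by simp
    have "\<bar>(?P A)\<^sup>2 - (?P B)\<^sup>2\<bar> = \<bar>?P A - ?P B\<bar> * (?P A + ?P B)"
      by (simp add: power2_eq_square square_diff_square_factored abs_mult)
    also have "\<dots> \<le> d * 2"
      using P.abs_measure_diff_le_sym_diff[OF A B(1)] B(2) P.prob_le_1[of A] P.prob_le_1[of B] d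
      by (intro mult_mono add_nonneg_nonneg measure_nonneg) linarith+
    finally have "\<bar>(?P A)\<^sup>2 - (?P B)\<^sup>2\<bar> \<le> 2 * d" by simp
    with 1 show ?thesis unfolding d_def by linarith
  qed
  then have "\<bar>?P A - (?P A)\<^sup>2\<bar> \<le> 0"
    by (rule field_le_epsilon[where y = 0, simplified]) 
  then show ?thesis by (simp add: power2_eq_square)
qed

end

section \<open>A zero-infinity law along i.i.d. products\<close>

text \<open>A function that is not almost surely constant has a level \<open>s\<close> for which
  neither alternative of \<open>AE_eq_constI\<close> holds. The upper threshold can be raised a
  little, since otherwise \<open>g x \<le> s\<close> would follow almost surely in the
  limit.\<close>

lemma (in prob_space) not_AE_const_split:
  fixes g :: "'a \<Rightarrow> real"
  assumes [measurable]: "g \<in> borel_measurable M"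
    and nonconst: "\<not> (\<exists>s. AE x in M. g x = s)"
  obtains s s' where "s < s'" "\<not> (AE x in M. g x \<le> s')" "\<not> (AE x in M. s < g x)"
proof -
  \<comment> \<open>\<open>AE_eq_constI\<close> asks for a complete order, hence the passage to
    extended reals; the level turns out to be finite.\<close>
  have "\<not> (\<forall>z. (AE x in M. ereal (g x) \<le> z) \<or> (AE x in M. z < ereal (g x)))"
  proof
    assume "\<forall>z. (AE x in M. ereal (g x) \<le> z) \<or> (AE x in M. z < ereal (g x))"
    then obtain z where z: "AE x in M. ereal (g x) = z"
      using AE_eq_constI[of "\<lambda>x. ereal (g x)"] by auto
    have "\<exists>x. ereal (g x) = z"
      using eventually_happens'[OF _ z] by (simp add: ae_filter_eq_bot_iff emeasure_space_1)
    then obtain t where "z = ereal t" by auto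
    with z nonconst show False by auto
  qed
  then obtain z where z: "\<not> (AE x in M. ereal (g x) \<le> z)" "\<not> (AE x in M. z < ereal (g x))"
    by auto
  then obtain s where s: "z = ereal s" by (cases z) auto
  have "\<exists>n. \<not> (AE x in M. g x \<le> s + 1 / real (Suc n))"
  proof (rule ccontr)
    assume "\<not> ?thesis"
    then have "AE x in M. \<forall>n. g x \<le> s + 1 / real (Suc n)"
      by (simp add: AE_all_countable)
    then have "AE x in M. g x \<le> s"
    proof eventually_elim
      case (elim x)
      have "(\<lambda>n. s + 1 / real (Suc n)) \<longlonglongrightarrow> s + 0"
        by (intro tendsto_intros LIMSEQ_Suc[OF lim_1_over_n])
      with elim show ?case by (intro LIMSEQ_le_const[of _ s]) auto
    qed
    with z(1) s show False by simp
  qed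
  then obtain n where "\<not> (AE x in M. g x \<le> s + 1 / real (Suc n))" by blast
  with z(2) s show ?thesis by (intro that[of s "s + 1 / real (Suc n)"]) auto
qed

text \<open>
  Along two sequences of letters, \<open>u\<close> and \<open>v\<close> are the logarithms of the numbers of words and \<open>t\<close> and
  \<open>w\<close> are minus the logarithms of their contraction ratios.
\<close>

lemma overtaking_indices:
  fixes u t v w :: "nat \<Rightarrow> real"
  assumes "s < s'" "0 \<le> s"
    and t: "filterlim t at_top sequentially" and w: "filterlim w at_top sequentially"
    and w0: "w 0 = 0" and step: "\<And>n. w (Suc n) \<le> w n + K" and "0 \<le> K"
    and u: "\<And>n. s' * t n \<le> u n" and v: "\<And>n. v n \<le> s * w n"
  shows "\<exists>m n. t m \<le> w n \<and> v n < u m"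
proof -
  \<comment> \<open>The second bound is what \<open>s * (t m + K) < s' * t m\<close> amounts to; the
    bound \<open>1\<close> puts \<open>t m\<close> above \<open>w 0\<close>, so that the index
    \<open>n\<close> below has a predecessor.\<close>
  have "\<forall>\<^sub>F m in sequentially. max 1 (s * K / (s' - s) + 1) \<le> t m"
    using t unfolding filterlim_at_top by (rule spec)
  then obtain m where m: "1 \<le> t m" "s * K / (s' - s) < t m"
    by (auto simp: eventually_sequentially)
  have "\<forall>\<^sub>F n in sequentially. t m \<le> w n"
    using w by (simp add: filterlim_at_top)
  then have ex: "\<exists>n. t m \<le> w n"
    by (auto simp: eventually_sequentially)
  \<comment> \<open>At the first passage over \<open>t m\<close> the overshoot is at most one step,
    that is, at most \<open>K\<close>.\<close>
  define n where "n = (LEAST n. t m \<le> w n)"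
  have n: "t m \<le> w n" unfolding n_def by (rule LeastI_ex[OF ex])
  with m w0 have "n \<noteq> 0" by (intro notI) auto
  then obtain k where k: "n = Suc k" by (cases n) auto
  then have "w k < t m"
    using not_less_Least[of k "\<lambda>n. t m \<le> w n"] by (simp add: n_def)
  with step[of k] k have "w n \<le> t m + K" by simp
  then have "v n \<le> s * (t m + K)"
    using v[of n] mult_left_mono[OF _ \<open>0 \<le> s\<close>] by (meson order_trans)
  also have "\<dots> < s' * t m"
    using m(2) \<open>s < s'\<close> by (simp add: field_simps)
  finally have "v n < u m" using u[of m] by simp
  with n show ?thesis by blast
qed

section \<open>Exchangeable functions and the lower limit along random products\<close>

lemma (in sequence_space) exchangeable_AE_const:
  fixes g :: "(nat \<Rightarrow> 'a) \<Rightarrow> ereal"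
  assumes [measurable]: "g \<in> borel_measurable S"
    and exch: "\<And>\<pi> n \<omega>. \<pi> permutes {..<n} \<Longrightarrow> \<omega> \<in> space S \<Longrightarrow> g (\<omega> \<circ> \<pi>) = g \<omega>"
  shows "\<exists>z. AE \<omega> in S. g \<omega> = z"
proof (rule P.AE_eq_constI)
  fix z
  let ?A = "{\<omega>\<in>space S. g \<omega> \<le> z}"
  have A: "?A \<in> sets S"
    using assms(1) by (rule borel_measurable_le[OF _ borel_measurable_const])
  have "measure S ?A = 0 \<or> measure S ?A = 1"
  proof (rule hewitt_savage_zero_one[OF A])
    fix \<pi> n \<omega> assume *: "\<pi> permutes {..<n::nat}" "\<omega> \<in> space S"
    from *(2) have "\<omega> \<circ> \<pi> \<in> space S" by (rule compose_in_space)
    with *(2) show "\<omega> \<circ> \<pi> \<in> ?A \<longleftrightarrow> \<omega> \<in> ?A"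
      unfolding mem_Collect_eq exch[OF *] by blast
  qed
  then show "(AE \<omega> in S. g \<omega> \<le> z) \<or> (AE \<omega> in S. z < g \<omega>)"
  proof
    assume "measure S ?A = 1"
    then show ?thesis using P.AE_prob_1[of ?A] by auto
  next
    assume "measure S ?A = 0"
    then have "AE \<omega> in S. \<omega> \<notin> ?A"
      using A by (intro AE_not_in) (auto simp: P.emeasure_eq_measure)
    then have "AE \<omega> in S. z < g \<omega>"
      using AE_space by eventually_elim auto
    then show ?thesis ..
  qed
qed measurable

text \<open>In the application \<open>p\<close> is the number of maps of a letter, \<open>q\<close>
  their ratio and \<open>r\<close> the diameter of \<open>\<Delta>\<close>, so the terms are the
  costs of covering by all cylinders of one level. The scale \<open>r\<close> stays a parameter
  because removing a letter changes it.\<close>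

definition gauge_liminf ::
    "('a \<Rightarrow> real) \<Rightarrow> ('a \<Rightarrow> real) \<Rightarrow> (real \<Rightarrow> real) \<Rightarrow> real \<Rightarrow> (nat \<Rightarrow> 'a) \<Rightarrow> ereal" where
  "gauge_liminf p q h r \<omega> = liminf (\<lambda>k. ereal ((\<Prod>i<k. p (\<omega> i)) * h (r * (\<Prod>i<k. q (\<omega> i)))))"

context sequence_space
begin

context
  fixes p q :: "'a \<Rightarrow> real" and h :: "real \<Rightarrow> real" and a b :: real
  assumes p_meas[measurable]: "p \<in> borel_measurable M"
    and q_meas[measurable]: "q \<in> borel_measurable M"
    and p_ge: "\<And>x. x \<in> space M \<Longrightarrow> 1 \<le> p x"
    and q_bounds: "\<And>x. x \<in> space M \<Longrightarrow> a \<le> q x \<and> q x \<le> b"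
    and ab: "0 < a" "b < 1"
    and h_mono: "mono h" and h_nonneg: "\<And>x. 0 \<le> h x"
begin

lemma measurable_gauge_liminf: "gauge_liminf p q h r \<in> borel_measurable S"
proof -
  have [measurable]: "h \<in> borel_measurable borel"
    using h_mono by (rule borel_measurable_mono)
  show ?thesis unfolding gauge_liminf_def by measurable
qed

text \<open>Products over at least \<open>n\<close> letters ignore a permutation of the first
  \<open>n\<close>, and a lower limit ignores its first \<open>n\<close> terms.\<close>

lemma gauge_liminf_permute:
  assumes "\<pi> permutes {..<n}"
  shows "gauge_liminf p q h r (\<omega> \<circ> \<pi>) = gauge_liminf p q h r \<omega>"
proof -
  have prod: "(\<Prod>i<k + n. g ((\<omega> \<circ> \<pi>) i)) = (\<Prod>i<k + n. g (\<omega> i))" for g :: "'a \<Rightarrow> real" and k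
  proof -
    have "\<pi> permutes {..<k + n}"
      using assms by (rule permutes_subset) auto
    from prod.permute[OF this, of "\<lambda>i. g (\<omega> i)"] show ?thesis by (simp add: comp_def)
  qed
  have "gauge_liminf p q h r \<omega>' = liminf (\<lambda>k. ereal ((\<Prod>i<k + n. p (\<omega>' i)) * h (r * (\<Prod>i<k + n. q (\<omega>' i)))))"
    for \<omega>' unfolding gauge_liminf_def
    by (rule liminf_shift_k[symmetric])
  then show ?thesis by (simp only: prod)
qed

text \<open>After dropping the term \<open>k = 0\<close>, the letter \<open>x\<close> contributes
  the factor \<open>p x\<close> outside and rescales \<open>r\<close> inside the gauge.\<close>

lemma gauge_liminf_case_nat:
  assumes "x \<in> space M"
  shows "gauge_liminf p q h r (case_nat x \<omega>) = ereal (p x) * gauge_liminf p q h (r * q x) \<omega>"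
proof -
  have "gauge_liminf p q h r (case_nat x \<omega>) =
     liminf (\<lambda>k. ereal ((\<Prod>i<k + 1. p (case_nat x \<omega> i)) * h (r * (\<Prod>i<k + 1. q (case_nat x \<omega> i)))))"
    unfolding gauge_liminf_def by (rule liminf_shift[symmetric])
  also have "\<dots> = liminf (\<lambda>k. ereal (p x) * ereal ((\<Prod>i<k. p (\<omega> i)) * h (r * q x * (\<Prod>i<k. q (\<omega> i)))))"
    by (simp add: prod.lessThan_Suc_shift mult.assoc del: prod.lessThan_Suc)
  also have "\<dots> = ereal (p x) * gauge_liminf p q h (r * q x) \<omega>"
    unfolding gauge_liminf_def using p_ge[OF assms] by (intro Liminf_ereal_mult_left) auto
  finally show ?thesis .
qed

lemma gauge_liminf_mono:
  assumes "\<omega> \<in> space S" "r \<le> r'"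
  shows "gauge_liminf p q h r \<omega> \<le> gauge_liminf p q h r' \<omega>"
proof -
  have "\<omega> i \<in> space M" for i using assms(1) by (auto simp: space_PiM)
  then have "0 \<le> q (\<omega> i)" "0 \<le> p (\<omega> i)" for i
    using q_bounds[of "\<omega> i"] p_ge[of "\<omega> i"] ab by force+
  then show ?thesis
    unfolding gauge_liminf_def using assms(2)
    by (intro Liminf_mono always_eventually allI) 
      (auto intro!: mult_left_mono monoD[OF h_mono] mult_right_mono prod_nonneg)
qed

theorem gauge_liminf_zero_infty:
  assumes nondet: "\<not> (\<exists>s. AE x in M. p x * q x powr s = 1)"
    and r: "0 < r"
  shows "AE \<omega> in S. gauge_liminf p q h r \<omega> \<in> {0, \<infinity>}"
proof -
  have "\<forall>r. \<exists>z. AE \<omega> in S. gauge_liminf p q h r \<omega> = z"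
    by (intro allI exchangeable_AE_const measurable_gauge_liminf gauge_liminf_permute)
  then obtain B where B: "\<And>r. AE \<omega> in S. gauge_liminf p q h r \<omega> = B r" by metis
  \<comment> \<open>\<open>B r\<close> and \<open>B r'\<close> are constants, so an inequality
    between them that holds almost surely holds outright.\<close>
  have B_mono: "B r \<le> B r'" if "r \<le> r'" for r r'
  proof -
    have "AE \<omega> in S. B r \<le> B r'"
      using B[of r] B[of r'] AE_space
      by eventually_elim (use gauge_liminf_mono that in metis)
    then show ?thesis by simp
  qed
  have B_nonneg: "0 \<le> B r" for r
  proof -
    have "AE \<omega> in S. 0 \<le> B r"
      using B[of r] AE_space
    proof eventually_elim
      case (elim \<omega>)
      then have "\<omega> i \<in> space M" for i by (auto simp: space_PiM)
      then have "0 \<le> gauge_liminf p q h r \<omega>" unfolding gauge_liminf_def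
        using p_ge by (intro Liminf_bounded always_eventually allI)
          (auto intro!: mult_nonneg_nonneg prod_nonneg h_nonneg intro: order_trans[OF zero_le_one])
      with elim show ?case by simp
    qed
    then show ?thesis by simp
  qed
  \<comment> \<open>By \<open>PiM_iter\<close>, prefixing an independent letter reproduces
    \<open>S\<close>; Fubini then separates that letter from the tail.\<close>
  have B_step: "AE x in M. B r = ereal (p x) * B (r * q x)" for r
  proof -
    interpret MS: pair_sigma_finite M S ..
    have "AE \<omega> in distr (M \<Otimes>\<^sub>M S) S (\<lambda>(x, \<omega>). case_nat x \<omega>). gauge_liminf p q h r \<omega> = B r"
      unfolding PiM_iter by (rule B)
    then have "AE z in M \<Otimes>\<^sub>M S. gauge_liminf p q h r (case_nat (fst z) (snd z)) = B r"
      by (auto dest!: AE_distrD[rotated] simp: split_beta')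
    then have "AE x in M. AE \<omega> in S. gauge_liminf p q h r (case_nat x \<omega>) = B r"
      by (auto dest: MS.AE_pair)
    then show ?thesis
      using AE_space
    proof eventually_elim
      case (elim x)
      have "AE \<omega> in S. B r = ereal (p x) * B (r * q x)"
        using elim(1) B[of "r * q x"] by eventually_elim (simp add: gauge_liminf_case_nat elim(2))
      then show ?case by simp
    qed
  qed
  \<comment> \<open>The exceptional null set of \<open>B_step\<close> depends on the scale, and each
    chosen letter changes the scale. So \<open>Y t\<close> selects a letter good for scale
    \<open>t\<close>, and the scales are threaded through a recursion. As \<open>Q\<close> has no
    null complement to hide in, such a letter always exists.\<close>
  have chain: "\<exists>x :: nat \<Rightarrow> 'a. \<forall>n. x n \<in> space M \<and> Q (x n) \<and>
      B r = ereal (\<Prod>i<n. p (x i)) * B (r * (\<Prod>i<n. q (x i)))"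
    if Q: "\<not> (AE x in M. \<not> Q x)" for Q
  proof -
    have "\<forall>t. \<exists>y. y \<in> space M \<and> Q y \<and> B t = ereal (p y) * B (t * q y)"
    proof (rule allI, rule ccontr)
      fix t assume *: "\<nexists>y. y \<in> space M \<and> Q y \<and> B t = ereal (p y) * B (t * q y)"
      have "AE x in M. \<not> Q x"
        using B_step[of t] AE_space by eventually_elim (use * in blast)
      with Q show False ..
    qed
    then obtain Y where Y: "\<And>t. Y t \<in> space M" "\<And>t. Q (Y t)"
      "\<And>t. B t = ereal (p (Y t)) * B (t * q (Y t))" by metis
    define t where "t = rec_nat r (\<lambda>_ t. t * q (Y t))"
    have t_simps: "t 0 = r" "t (Suc n) = t n * q (Y (t n))" for n
      by (simp_all add: t_def)
    have t: "t n = r * (\<Prod>i<n. q (Y (t i)))" for n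
      by (induction n) (simp_all add: t_simps)
    have "B r = ereal (\<Prod>i<n. p (Y (t i))) * B (t n)" for n
    proof (induction n)
      case (Suc n)
      then show ?case
        using Y(3)[of "t n"] by (simp add: t_simps mult.assoc flip: times_ereal.simps(1))
    qed (simp add: t_simps flip: one_ereal_def)
    then have "B r = ereal (\<Prod>i<n. p (Y (t i))) * B (r * (\<Prod>i<n. q (Y (t i))))" for n
      unfolding t[symmetric] .
    with Y(1,2) have "\<forall>n. Y (t n) \<in> space M \<and> Q (Y (t n)) \<and>
        B r = ereal (\<Prod>i<n. p (Y (t i))) * B (r * (\<Prod>i<n. q (Y (t i))))"
      by (intro allI conjI)
    then show ?thesis by (rule exI[of _ "\<lambda>n. Y (t n)"])
  qed
  have "B r \<in> {0, \<infinity>}"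
  proof (rule ccontr)
    assume "B r \<notin> {0, \<infinity>}"
    with B_nonneg[of r] obtain \<beta> where \<beta>: "B r = ereal \<beta>" "0 < \<beta>"
      by (cases "B r") auto
    \<comment> \<open>\<open>g x\<close> is the exponent \<open>s\<close> that solves
      \<open>p x * q x powr s = 1\<close>, so \<open>nondet\<close> forbids it to be almost surely
      constant.\<close>
    define g where "g x = ln (p x) / - ln (q x)" for x
    have q_pos: "0 < q x" and q_lt: "q x < 1" if "x \<in> space M" for x
      using q_bounds[OF that] ab by auto
    have ln_q: "- ln b \<le> - ln (q x)" "- ln (q x) \<le> - ln a" "0 < - ln (q x)" if "x \<in> space M" for x
      using q_bounds[OF that] q_pos[OF that] q_lt[OF that] ab by auto
    have ln_p: "ln (p x) = g x * - ln (q x)" "0 \<le> g x" if "x \<in> space M" for x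
      using ln_q(3)[OF that] p_ge[OF that] by (auto simp: g_def intro!: divide_nonneg_neg)
    have "\<not> (\<exists>s. AE x in M. g x = s)"
    proof
      assume "\<exists>s. AE x in M. g x = s"
      then obtain s where "AE x in M. g x = s" ..
      then have "AE x in M. p x * q x powr s = 1"
        using AE_space
      proof eventually_elim
        case (elim x)
        have "p x * q x powr s = exp (ln (p x)) * exp (s * ln (q x))"
          using p_ge[OF elim(2)] q_pos[OF elim(2)] by (simp add: powr_def)
        also have "\<dots> = 1"
          using ln_p(1)[OF elim(2)] elim(1) by (simp flip: exp_add)
        finally show ?case .
      qed
      with nondet show False by blast
    qed
    then obtain s s' where s: "s < s'" "\<not> (AE x in M. g x \<le> s')" "\<not> (AE x in M. s < g x)"
      by (rule M.not_AE_const_split[rotated]) (auto simp: g_def)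
    have "\<not> (AE x in M. \<not> s' < g x)"
      using s(2) by (simp add: not_less)
    from chain[OF this] obtain x :: "nat \<Rightarrow> 'a" where "\<forall>n. x n \<in> space M \<and> s' < g (x n) \<and>
        B r = ereal (\<Prod>i<n. p (x i)) * B (r * (\<Prod>i<n. q (x i)))" ..
    then have x: "x n \<in> space M" "s' < g (x n)"
      "B r = ereal (\<Prod>i<n. p (x i)) * B (r * (\<Prod>i<n. q (x i)))" for n by simp_all
    have "\<not> (AE x in M. \<not> g x \<le> s)"
      using s(3) by (simp add: not_le)
    from chain[OF this] obtain y :: "nat \<Rightarrow> 'a" where "\<forall>n. y n \<in> space M \<and> g (y n) \<le> s \<and>
        B r = ereal (\<Prod>i<n. p (y i)) * B (r * (\<Prod>i<n. q (y i)))" ..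
    then have y: "y n \<in> space M" "g (y n) \<le> s"
      "B r = ereal (\<Prod>i<n. p (y i)) * B (r * (\<Prod>i<n. q (y i)))" for n by simp_all
    have lim: "filterlim (\<lambda>n. \<Sum>i<n. - ln (q (z i))) at_top sequentially"
      if "\<And>n. z n \<in> space M" for z
    proof (rule filterlim_at_top_mono)
      have "0 < - ln b"
        using ab q_bounds[OF that[of 0]] by auto
      then show "filterlim (\<lambda>n. real n * - ln b) at_top sequentially"
        by (intro filterlim_at_top_mult_tendsto_pos[OF tendsto_const] filterlim_real_sequentially)
      show "\<forall>\<^sub>F n in sequentially. real n * - ln b \<le> (\<Sum>i<n. - ln (q (z i)))"
        using sum_mono[of "{..<n}" "\<lambda>_. - ln b" "\<lambda>i. - ln (q (z i))" for n] ln_q(1)[OF that]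
        by (intro always_eventually) auto
    qed
    \<comment> \<open>A finite piece of \<open>x\<close> is to carry more words than a finite piece
      of \<open>y\<close> although it contracts no more; the one-step bound \<open>K\<close> is
      \<open>- ln a\<close>.\<close>
    have "\<exists>m n. (\<Sum>i<m. - ln (q (x i))) \<le> (\<Sum>i<n. - ln (q (y i))) \<and>
        (\<Sum>i<n. ln (p (y i))) < (\<Sum>i<m. ln (p (x i)))"
    proof (rule overtaking_indices[OF s(1) _ lim lim])
      show "0 \<le> s" using ln_p(2)[OF y(1)[of 0]] y(2)[of 0] by simp
      show "0 \<le> - ln a" using ln_q[OF y(1)[of 0]] by simp
      show "s' * (\<Sum>i<n. - ln (q (x i))) \<le> (\<Sum>i<n. ln (p (x i)))" for n
        unfolding sum_distrib_left
      proof (rule sum_mono)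
        fix i
        show "s' * - ln (q (x i)) \<le> ln (p (x i))"
          using mult_right_mono[of s' "g (x i)" "- ln (q (x i))"] x(2)[of i] ln_q(3)[OF x(1)[of i]]
            ln_p(1)[OF x(1)[of i]] by linarith
      qed
      show "(\<Sum>i<n. ln (p (y i))) \<le> s * (\<Sum>i<n. - ln (q (y i)))" for n
        unfolding sum_distrib_left
      proof (rule sum_mono)
        fix i
        show "ln (p (y i)) \<le> s * - ln (q (y i))"
          using mult_right_mono[of "g (y i)" s "- ln (q (y i))"] y(2)[of i] ln_q(3)[OF y(1)[of i]]
            ln_p(1)[OF y(1)[of i]] by linarith
      qed
    qed (use x(1) y(1) ln_q(2)[OF y(1)] in auto)
    then obtain m n where
        mn: "(\<Sum>i<m. - ln (q (x i))) \<le> (\<Sum>i<n. - ln (q (y i)))"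
          "(\<Sum>i<n. ln (p (y i))) < (\<Sum>i<m. ln (p (x i)))" by blast
    let ?px = "\<Prod>i<m. p (x i)" and ?py = "\<Prod>i<n. p (y i)"
    let ?qx = "\<Prod>i<m. q (x i)" and ?qy = "\<Prod>i<n. q (y i)"
    have p_pos: "0 < p z" if "z \<in> space M" for z using p_ge[OF that] by simp
    have pos: "0 < ?px" "0 < ?py" "0 < ?qx" "0 < ?qy"
      using x(1) y(1) p_pos q_pos by (auto intro!: prod_pos)
    have "ln ?py < ln ?px"
      using mn(2) x(1) y(1) p_pos by (subst (1 2) ln_prod) (auto simp: less_imp_neq[symmetric])
    then have p_less: "?py < ?px" using pos by simp
    have "ln ?qy \<le> ln ?qx"
      using mn(1) x(1) y(1) q_pos by (subst (1 2) ln_prod) (auto simp: sum_negf less_imp_neq[symmetric])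
    then have q_le: "?qy \<le> ?qx" using pos by simp
    have div: "z = ereal (\<beta> / P)" if "B r = ereal P * z" "0 < P" for z P
      using that \<beta>(1) by (cases z) (auto simp: field_simps)
    \<comment> \<open>Dividing by the larger \<open>?px\<close> makes \<open>B\<close> strictly
      smaller at the scale \<open>r * ?qx\<close>, which is not the smaller one: this contradicts
      \<open>B_mono\<close>. Finiteness and positivity of \<open>\<beta>\<close> enter here.\<close>
    have "B (r * ?qx) = ereal (\<beta> / ?px)"
      by (rule div[OF x(3) pos(1)])
    moreover have "B (r * ?qy) = ereal (\<beta> / ?py)"
      by (rule div[OF y(3) pos(2)])
    moreover have "B (r * ?qy) \<le> B (r * ?qx)"
      using q_le r by (intro B_mono mult_left_mono) auto
    moreover have "\<beta> / ?px < \<beta> / ?py"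
      using p_less pos \<beta> by (intro divide_strict_left_mono) auto
    ultimately show False by simp
  qed
  then show ?thesis using B[of r] by auto
qed

end

end

section \<open>Hausdorff measure along a fixed sequence of systems\<close>

lemma gauge_functionD:
  assumes "gauge_function h"
  shows gauge_nonneg: "0 \<le> r \<Longrightarrow> 0 \<le> h r"
    and gauge_mono: "0 \<le> r \<Longrightarrow> r \<le> r' \<Longrightarrow> h r \<le> h r'"
    and gauge_zero: "h 0 = 0"
proof -
  show nonneg: "0 \<le> r \<Longrightarrow> 0 \<le> h r" for r using assms by (simp add: gauge_function_def)
  show mono: "0 \<le> r \<Longrightarrow> r \<le> r' \<Longrightarrow> h r \<le> h r'" for r r'
    using assms by (auto simp: gauge_function_def mono_on_def)
  have "(h \<longlongrightarrow> 0) (at_right 0)"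
    using assms by (simp add: gauge_function_def)
  moreover have "\<forall>\<^sub>F r in at_right 0. h 0 \<le> h r"
    using eventually_at_right_less[of 0] by eventually_elim (auto intro: mono)
  ultimately have "h 0 \<le> 0"
    by (rule tendsto_lowerbound) simp
  with nonneg[of 0] show "h 0 = 0" by simp
qed

text \<open>Rescaling by \<open>\<rho>\<close> moves the points into \<open>cball 0 T\<close>, which
  finitely many balls of radius \<open>1/2\<close> cover. Two points in the same small ball would be
  closer than \<open>\<rho>\<close>, so the number of balls bounds the number of points, uniformly
  in \<open>u\<close> and \<open>\<rho>\<close>.\<close>

lemma separated_subsets_of_ball_bounded:
  fixes T :: real
  shows "\<exists>C::nat. \<forall>(X :: 'a::euclidean_space set) u \<rho>. 0 < \<rho> \<longrightarrow> X \<subseteq> ball u (T * \<rho>) \<longrightarrow>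
    (\<forall>x\<in>X. \<forall>y\<in>X. x \<noteq> y \<longrightarrow> \<rho> \<le> dist x y) \<longrightarrow> finite X \<and> card X \<le> C"
proof -
  obtain K :: "'a set" where K: "finite K" "cball 0 T \<subseteq> (\<Union>x\<in>K. ball x (1/2))"
    using compact_cball[of "0::'a" T] unfolding compact_eq_totally_bounded
    by (meson half_gt_zero_iff zero_less_one)
  have *: "finite X \<and> card X \<le> card K"
    if \<rho>: "0 < \<rho>" and X: "X \<subseteq> ball u (T * \<rho>)" "\<forall>x\<in>X. \<forall>y\<in>X. x \<noteq> y \<longrightarrow> \<rho> \<le> dist x y"
    for X :: "'a set" and u \<rho>
  proof -
    have "\<exists>k\<in>K. dist k ((x - u) /\<^sub>R \<rho>) < 1/2" if "x \<in> X" for x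
    proof -
      have "norm ((x - u) /\<^sub>R \<rho>) \<le> T"
        using that X(1) \<rho> by (auto simp: dist_norm norm_minus_commute divide_simps mult.commute)
      then have "(x - u) /\<^sub>R \<rho> \<in> cball 0 T" by (simp only: mem_cball_0)
      with K(2) have "(x - u) /\<^sub>R \<rho> \<in> (\<Union>k\<in>K. ball k (1/2))" ..
      then show ?thesis by (simp only: UN_iff mem_ball)
    qed
    then obtain k where k: "\<And>x. x \<in> X \<Longrightarrow> k x \<in> K" "\<And>x. x \<in> X \<Longrightarrow> dist (k x) ((x - u) /\<^sub>R \<rho>) < 1/2"
      by metis
    have "inj_on k X"
    proof (rule inj_onI, rule ccontr)
      fix x y assume xy: "x \<in> X" "y \<in> X" "k x = k y" "x \<noteq> y"
      have "dist ((x - u) /\<^sub>R \<rho>) ((y - u) /\<^sub>R \<rho>) < 1"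
        using k(2)[OF xy(1)] k(2)[OF xy(2)] xy(3)
          dist_triangle3[of "(x - u) /\<^sub>R \<rho>" "(y - u) /\<^sub>R \<rho>" "k x"] by simp
      also have "dist ((x - u) /\<^sub>R \<rho>) ((y - u) /\<^sub>R \<rho>) = dist x y / \<rho>"
        using \<rho> by (simp add: dist_norm divide_simps flip: scaleR_diff_right)
      finally show False using X(2) xy(1,2,4) \<rho> by fastforce
    qed
    with K(1) k(1) show ?thesis
      using card_inj_on_le[of k X K] inj_on_finite[of k X K] by blast
  qed
  show ?thesis by (intro exI[of _ "card K"] allI impI) (rule *)
qed

text \<open>The point is surjectivity: translated and divided by \<open>\<rho>\<close>, the map is
  an isometry fixing the origin, hence orthogonal, hence onto.\<close>

lemma ball_subset_similarity_image:
  fixes g :: "'a::euclidean_space \<Rightarrow> 'a"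
  assumes "0 < \<rho>" and g: "\<And>x y. dist (g x) (g y) = \<rho> * dist x y"
  shows "ball (g a) (\<rho> * s) \<subseteq> g ` ball a s"
proof
  fix z assume z: "z \<in> ball (g a) (\<rho> * s)"
  define t where "t x = (g x - g 0) /\<^sub>R \<rho>" for x
  have "dist (t x) (t y) = dist x y" for x y
    using assms(1) g[of x y]
    by (simp add: t_def dist_norm divide_simps mult.commute flip: scaleR_diff_right)
  then have "orthogonal_transformation t"
    by (simp add: orthogonal_transformation_isometry t_def)
  then obtain x where "t x = (z - g 0) /\<^sub>R \<rho>"
    by (metis orthogonal_transformation_surj surjD)
  with assms(1) have x: "z = g x" by (simp add: t_def)
  with z g[of a x] assms(1) show "z \<in> g ` ball a s" by auto
qed

section \<open>Words, cylinders and the attractor of one sequence of systems\<close>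

lemma composed_map_cong:
  "(\<And>i. i < k \<Longrightarrow> j i = j' i) \<Longrightarrow> composed_map f \<omega> j k = composed_map f \<omega> j' k"
  by (induction k) simp_all

text \<open>One realisation \<open>\<omega>\<close> is frozen, so that everything here is
  deterministic. Equicontractivity is built in: \<open>r k\<close> is the ratio of all maps at step
  \<open>k\<close>.\<close>

locale nonautonomous_ifs =
  fixes N :: "'l \<Rightarrow> nat" and f :: "'l \<Rightarrow> nat \<Rightarrow> 'a::euclidean_space \<Rightarrow> 'a"
    and \<Delta> :: "'a set" and \<omega> :: "nat \<Rightarrow> 'l" and r :: "nat \<Rightarrow> real"
  assumes N_pos: "1 \<le> N (\<omega> k)"
    and r_pos: "0 < r k"
    and similar: "i \<in> {1..N (\<omega> k)} \<Longrightarrow> dist (f (\<omega> k) i x) (f (\<omega> k) i y) = r k * dist x y"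
    and compact_Delta: "compact \<Delta>"
    and invariant_Delta: "i \<in> {1..N (\<omega> k)} \<Longrightarrow> f (\<omega> k) i ` \<Delta> \<subseteq> \<Delta>"
begin

text \<open>Extensional functions make each index string of length \<open>k\<close> occur exactly
  once, so words can be counted, whereas the attractor is defined with sequences constrained only
  below \<open>k\<close>.\<close>

definition words :: "nat \<Rightarrow> (nat \<Rightarrow> nat) set" where
  "words k = (\<Pi>\<^sub>E i\<in>{..<k}. {1..N (\<omega> i)})"

definition P :: "nat \<Rightarrow> real" where "P k = (\<Prod>i<k. real (N (\<omega> i)))"

definition R :: "nat \<Rightarrow> real" where "R k = (\<Prod>i<k. r i)"

abbreviation comp where "comp \<equiv> composed_map f \<omega>"

abbreviation attractor where "attractor \<equiv> homogeneous_attractor N f \<Delta> \<omega>"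

lemma finite_words: "finite (words k)"
  unfolding words_def by (intro finite_PiE) auto

lemma card_words: "real (card (words k)) = P k"
  by (simp add: words_def card_PiE P_def)

lemma R_pos: "0 < R k"
  unfolding R_def by (intro prod_pos r_pos)

lemma P_pos: "0 < P k"
  unfolding P_def using N_pos by (intro prod_pos) (simp add: Suc_le_eq)

lemma wordsD: "w \<in> words k \<Longrightarrow> i < k \<Longrightarrow> w i \<in> {1..N (\<omega> i)}"
  by (auto simp: words_def PiE_iff)

lemma dist_comp:
  assumes "\<And>i. i < k \<Longrightarrow> j i \<in> {1..N (\<omega> i)}"
  shows "dist (comp j k x) (comp j k y) = R k * dist x y"
  using assms
proof (induction k arbitrary: x y)
  case (Suc k)
  then show ?case by (simp add: R_def similar[of "j k" k] mult.assoc)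
qed (simp add: R_def)

lemma inj_comp:
  assumes "\<And>i. i < k \<Longrightarrow> j i \<in> {1..N (\<omega> i)}"
  shows "inj (comp j k)"
proof (rule injI)
  fix x y assume "comp j k x = comp j k y"
  with dist_comp[OF assms, of k x y] R_pos[of k] show "x = y" by simp
qed

lemma comp_image_antimono:
  assumes "\<And>i. i < k \<Longrightarrow> j i \<in> {1..N (\<omega> i)}" "m \<le> k"
    and "\<And>i l. i \<in> {1..N (\<omega> l)} \<Longrightarrow> f (\<omega> l) i ` X \<subseteq> X"
  shows "comp j k ` X \<subseteq> comp j m ` X"
  using assms(2,1)
proof (induction k rule: dec_induct)
  case (step k)
  have "comp j (Suc k) ` X = comp j k ` (f (\<omega> k) (j k) ` X)"
    by (simp add: image_comp)
  also have "\<dots> \<subseteq> comp j k ` X"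
    using step.prems by (intro image_mono assms(3)) auto
  finally show ?case using step by fastforce
qed simp

lemma compact_comp_image:
  assumes "\<And>i. i < k \<Longrightarrow> j i \<in> {1..N (\<omega> i)}"
  shows "compact (comp j k ` \<Delta>)"
proof (rule compact_continuous_image[OF _ compact_Delta])
  have "(R k)-lipschitz_on \<Delta> (comp j k)"
    using R_pos[of k] by (intro lipschitz_onI) (simp_all add: dist_comp[OF assms])
  then show "continuous_on \<Delta> (comp j k)"
    by (rule lipschitz_on_continuous_on)
qed

lemma attractor_eq: "attractor = (\<Inter>k\<in>{1..}. \<Union>w\<in>words k. comp w k ` \<Delta>)"
proof -
  have "(\<Union>j\<in>{j. \<forall>i<k. j i \<in> {1..N (\<omega> i)}}. comp j k ` \<Delta>) = (\<Union>w\<in>words k. comp w k ` \<Delta>)" for k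
  proof (intro equalityI UN_least)
    fix j assume j: "j \<in> {j. \<forall>i<k. j i \<in> {1..N (\<omega> i)}}"
    have "comp j k = comp (restrict j {..<k}) k"
      by (rule composed_map_cong) simp
    moreover have "restrict j {..<k} \<in> words k"
      using j by (auto simp: words_def)
    ultimately show "comp j k ` \<Delta> \<subseteq> (\<Union>w\<in>words k. comp w k ` \<Delta>)" by auto
  next
    fix w assume "w \<in> words k"
    then show "comp w k ` \<Delta> \<subseteq> (\<Union>j\<in>{j. \<forall>i<k. j i \<in> {1..N (\<omega> i)}}. comp j k ` \<Delta>)"
      by (intro UN_upper) (auto dest: wordsD)
  qed
  then show ?thesis by (simp add: homogeneous_attractor_def)
qed

lemma compact_attractor: "compact attractor"
proof -
  have "compact (\<Union>w\<in>words k. comp w k ` \<Delta>)" for k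
    by (intro compact_UN finite_words compact_comp_image) (auto dest: wordsD)
  then show ?thesis
    unfolding attractor_eq by (intro compact_Inter) auto
qed

text \<open>Continue \<open>w\<close> forever by the index \<open>1\<close>, which is always
  admissible; the nested compact cylinders along this sequence have a common point.\<close>

lemma cylinder_meets_attractor:
  assumes w: "w \<in> words n" and "\<Delta> \<noteq> {}"
  shows "comp w n ` \<Delta> \<inter> attractor \<noteq> {}"
proof -
  define j where "j i = (if i < n then w i else 1)" for i
  have j: "j i \<in> {1..N (\<omega> i)}" for i
    using wordsD[OF w, of i] N_pos[of i] by (auto simp: j_def)
  have "(\<Inter>k. comp j k ` \<Delta>) \<noteq> {}"
  proof (rule compact_nest)
    show "comp j k ` \<Delta> \<subseteq> comp j m ` \<Delta>" if "m \<le> k" for m k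
      using j that invariant_Delta by (intro comp_image_antimono) auto
  qed (use j \<open>\<Delta> \<noteq> {}\<close> compact_comp_image in auto)
  then obtain x where x: "\<And>k. x \<in> comp j k ` \<Delta>" by blast
  have "comp j n = comp w n"
    by (rule composed_map_cong) (simp add: j_def)
  with x[of n] have "x \<in> comp w n ` \<Delta>" by simp
  moreover have "x \<in> attractor"
    unfolding homogeneous_attractor_def by (intro INT_I UN_I[of j] x) (use j in simp)
  ultimately show ?thesis by blast
qed

lemma P_split: "k \<le> n \<Longrightarrow> P n = P k * (\<Prod>i\<in>{k..<n}. real (N (\<omega> i)))"
  unfolding P_def by (subst prod.union_disjoint[symmetric]) (auto intro!: prod.cong)

text \<open>A word is determined by its prefix and its tail, and there are \<open>P n / P k\<close>
  tails.\<close>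

lemma card_words_restrict:
  assumes "k \<le> n" "finite A"
  shows "real (card {w\<in>words n. restrict w {..<k} \<in> A}) \<le> real (card A) * (P n / P k)"
proof -
  let ?V = "\<Pi>\<^sub>E i\<in>{k..<n}. {1..N (\<omega> i)}"
  have "card {w\<in>words n. restrict w {..<k} \<in> A} \<le> card (A \<times> ?V)"
  proof (rule card_inj_on_le)
    show "inj_on (\<lambda>w. (restrict w {..<k}, restrict w {k..<n})) {w\<in>words n. restrict w {..<k} \<in> A}"
    proof (rule inj_onI)
      fix w v
      assume wv: "w \<in> {w\<in>words n. restrict w {..<k} \<in> A}" "v \<in> {w\<in>words n. restrict w {..<k} \<in> A}"
        and "(restrict w {..<k}, restrict w {k..<n}) = (restrict v {..<k}, restrict v {k..<n})"
      then have *: "restrict w {..<k} = restrict v {..<k}" "restrict w {k..<n} = restrict v {k..<n}"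
        by auto
      have "w i = v i" if "i < n" for i
        using fun_cong[OF *(1), of i] fun_cong[OF *(2), of i] that by (cases "i < k") auto
      with wv show "w = v"
        by (intro PiE_ext[of w "{..<n}" "\<lambda>i. {1..N (\<omega> i)}" v]) (auto simp: words_def)
    qed
    show "(\<lambda>w. (restrict w {..<k}, restrict w {k..<n})) ` {w\<in>words n. restrict w {..<k} \<in> A} \<subseteq> A \<times> ?V"
      by (auto simp: words_def PiE_iff)
    show "finite (A \<times> ?V)"
      using assms(2) by (intro finite_cartesian_product finite_PiE) auto
  qed
  also have "card (A \<times> ?V) = card A * (\<Prod>i\<in>{k..<n}. N (\<omega> i))"
    by (simp add: card_cartesian_product card_PiE)
  finally have "card {w\<in>words n. restrict w {..<k} \<in> A} \<le> card A * (\<Prod>i\<in>{k..<n}. N (\<omega> i))" .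
  from of_nat_mono[OF this, where 'a = real]
  have "real (card {w\<in>words n. restrict w {..<k} \<in> A})
      \<le> real (card A) * (\<Prod>i\<in>{k..<n}. real (N (\<omega> i)))"
    by simp
  then show ?thesis using P_split[OF assms(1)] P_pos[of k] by simp
qed

text \<open>The cylinders of level \<open>k\<close> are \<open>P k\<close> sets of diameter at most
  \<open>diameter \<Delta> * R k\<close>. A zero lower limit makes their total cost small at
  infinitely many levels, hence at one whose cylinders are already finer than
  \<open>\<delta>\<close>.\<close>

lemma hausdorff_measure_zero:
  assumes h: "gauge_function h" and R0: "R \<longlonglongrightarrow> 0"
    and liminf: "liminf (\<lambda>k. ereal (P k * h (diameter \<Delta> * R k))) = 0"
  shows "hausdorff_measure h attractor = 0"
proof -
  let ?D = "diameter \<Delta>"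
  have D: "0 \<le> ?D" using compact_Delta by (intro diameter_ge_0 compact_imp_bounded)
  have "hausdorff_pre h \<delta> attractor \<le> ennreal e" if "0 < \<delta>" "0 < e" for \<delta> e
  proof -
    have "(\<lambda>k. ?D * R k) \<longlonglongrightarrow> ?D * 0" by (intro tendsto_intros R0)
    then have "\<forall>\<^sub>F k in sequentially. ?D * R k < \<delta>"
      using that(1) by (intro order_tendstoD) auto
    then have ev: "\<forall>\<^sub>F k in sequentially. 1 \<le> k \<and> ?D * R k < \<delta>"
      using eventually_ge_at_top[of 1] by eventually_elim simp
    have "\<exists>\<^sub>F k in sequentially. P k * h (?D * R k) < e"
      unfolding frequently_def
    proof
      assume "\<forall>\<^sub>F k in sequentially. \<not> P k * h (?D * R k) < e"
      then have "ereal e \<le> liminf (\<lambda>k. ereal (P k * h (?D * R k)))"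
        by (intro Liminf_bounded) (auto elim: eventually_mono)
      with liminf that(2) show False by simp
    qed
    from frequently_eventually_conj[OF this ev] obtain k where
      k: "1 \<le> k" "?D * R k < \<delta>" "P k * h (?D * R k) < e"
      by (auto dest!: frequently_ex)
    obtain b where b: "bij_betw b {..<card (words k)} (words k)"
      using ex_bij_betw_nat_finite[OF finite_words] by (auto simp: atLeast0LessThan)
    define U where "U i = (if i < card (words k) then comp (b i) k ` \<Delta> else {})" for i
    have diam: "diameter (U i) \<le> ?D * R k" "bounded (U i)" for i
    proof -
      show "bounded (U i)"
        using b by (auto simp: U_def bij_betw_def intro!: compact_imp_bounded compact_comp_image dest: wordsD)
      show "diameter (U i) \<le> ?D * R k"
      proof (rule diameter_le)
        show "U i \<noteq> {} \<or> 0 \<le> ?D * R k" using D R_pos[of k] by simp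
        fix x y assume "x \<in> U i" "y \<in> U i"
        then obtain x' y' where i: "i < card (words k)"
          and xy: "x' \<in> \<Delta>" "y' \<in> \<Delta>" "x = comp (b i) k x'" "y = comp (b i) k y'"
          by (auto simp: U_def split: if_splits)
        from i b have "b i \<in> words k" by (auto simp: bij_betw_def)
        then have "dist x y = R k * dist x' y'"
          unfolding xy by (intro dist_comp wordsD)
        also have "\<dots> \<le> R k * ?D"
          using R_pos[of k] xy(1,2) compact_Delta
          by (intro mult_left_mono diameter_bounded_bound compact_imp_bounded) auto
        finally show "norm (x - y) \<le> ?D * R k" by (simp add: dist_norm mult.commute)
      qed
    qed
    have "attractor \<subseteq> (\<Union>w\<in>words k. comp w k ` \<Delta>)"
      unfolding attractor_eq using k(1) by (intro INF_lower) auto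
    also have "\<dots> \<subseteq> (\<Union>i. U i)"
    proof (rule UN_least)
      fix w assume "w \<in> words k"
      with b obtain i where "i < card (words k)" "w = b i" by (auto simp: bij_betw_def)
      then have "comp w k ` \<Delta> = U i" by (simp add: U_def)
      then show "comp w k ` \<Delta> \<subseteq> (\<Union>i. U i)" by blast
    qed
    finally have "hausdorff_pre h \<delta> attractor \<le> (\<Sum>i. ennreal (h (diameter (U i))))"
      unfolding hausdorff_pre_def using diam k(2)
      by (intro INF_lower) (auto intro: order_trans[OF _ less_imp_le])
    also have "\<dots> = (\<Sum>i<card (words k). ennreal (h (diameter (U i))))"
      by (intro suminf_finite) (auto simp: U_def gauge_zero[OF h])
    also have "\<dots> \<le> (\<Sum>i<card (words k). ennreal (h (?D * R k)))"
      using diam by (intro sum_mono ennreal_leI gauge_mono[OF h] diameter_ge_0)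
    also have "\<dots> = ennreal (P k * h (?D * R k))"
      using D R_pos[of k] by (simp add: card_words[symmetric] ennreal_mult' ennreal_of_nat_eq_real_of_nat)
    also have "\<dots> \<le> ennreal e" using k(3) by (intro ennreal_leI) simp
    finally show ?thesis .
  qed
  then have "hausdorff_pre h \<delta> attractor = 0" if "0 < \<delta>" for \<delta>
    using that ennreal_le_epsilon[of 0 "hausdorff_pre h \<delta> attractor"] by auto
  then show ?thesis
    unfolding hausdorff_measure_eq_SUP by (simp add: SUP_eq_const)
qed


section \<open>Counting cylinders under the open set condition\<close>

lemma comp_images_disjoint:
  assumes inv: "\<And>i l. i \<in> {1..N (\<omega> l)} \<Longrightarrow> f (\<omega> l) i ` U \<subseteq> U"
    and disj: "\<And>l i i'. i \<in> {1..N (\<omega> l)} \<Longrightarrow> i' \<in> {1..N (\<omega> l)} \<Longrightarrow> i \<noteq> i' \<Longrightarrow>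
       f (\<omega> l) i ` U \<inter> f (\<omega> l) i' ` U = {}"
    and wv: "w \<in> words k" "v \<in> words k" "w \<noteq> v"
  shows "comp w k ` U \<inter> comp v k ` U = {}"
proof -
  have "\<exists>i<k. w i \<noteq> v i"
  proof (rule ccontr)
    assume "\<not> ?thesis"
    then have "w = v"
      using wv(1,2) by (intro PiE_ext[of w "{..<k}" "\<lambda>i. {1..N (\<omega> i)}" v]) (auto simp: words_def)
    with wv(3) show False ..
  qed
  \<comment> \<open>Up to the first difference \<open>p\<close> both words give the same injective
    map, which preserves the disjointness of the two images of \<open>U\<close> at step
    \<open>p\<close>; later letters only shrink them.\<close>
  define p where "p = (LEAST i. i < k \<and> w i \<noteq> v i)"
  have p: "p < k" "w p \<noteq> v p"
    using LeastI_ex[OF \<open>\<exists>i<k. w i \<noteq> v i\<close>] by (auto simp: p_def)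
  have eq: "comp v p = comp w p"
  proof (rule composed_map_cong)
    fix i assume "i < p"
    then show "v i = w i"
      using not_less_Least[of i "\<lambda>i. i < k \<and> w i \<noteq> v i", folded p_def] p(1) by simp
  qed
  have w: "w p \<in> {1..N (\<omega> p)}" and v: "v p \<in> {1..N (\<omega> p)}"
    using wordsD[OF wv(1) p(1)] wordsD[OF wv(2) p(1)] by auto
  have "comp w k ` U \<subseteq> comp w (Suc p) ` U" "comp v k ` U \<subseteq> comp v (Suc p) ` U"
    by (rule comp_image_antimono; use wordsD[OF wv(1)] wordsD[OF wv(2)] p(1) inv in auto)+
  moreover have "comp w (Suc p) ` U \<inter> comp v (Suc p) ` U = {}"
  proof -
    have "inj (comp w p)" using p(1) by (intro inj_comp wordsD[OF wv(1)]) simp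
    then show ?thesis
      using disj[OF w v p(2)]
      by (simp only: composed_map.simps(2) eq image_comp[symmetric] image_Int[symmetric] image_empty)
  qed
  ultimately show ?thesis by blast
qed

text \<open>Mark a point \<open>a\<close> of \<open>U\<close> with a ball of radius \<open>s\<close>
  around it. Its images under words of length \<open>k\<close> are \<open>R k * s\<close> apart
  because the images of \<open>U\<close> are disjoint, and those counted lie within
  \<open>(t + m) * R k\<close> of \<open>u\<close>, where \<open>m\<close> bounds the distance from
  \<open>a\<close> to points of \<open>\<Delta>\<close>. The packing bound depends only on
  \<open>(t + m) / s\<close>, not on \<open>k\<close>.\<close>

lemma cylinders_meeting_ball:
  assumes U: "open U" "U \<noteq> {}"
    and inv: "\<And>i l. i \<in> {1..N (\<omega> l)} \<Longrightarrow> f (\<omega> l) i ` U \<subseteq> U"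
    and disj: "\<And>l i i'. i \<in> {1..N (\<omega> l)} \<Longrightarrow> i' \<in> {1..N (\<omega> l)} \<Longrightarrow> i \<noteq> i' \<Longrightarrow>
       f (\<omega> l) i ` U \<inter> f (\<omega> l) i' ` U = {}"
  shows "\<exists>C. \<forall>k u. card {w\<in>words k. comp w k ` \<Delta> \<inter> ball u (t * R k) \<noteq> {}} \<le> C"
proof -
  from U obtain a where "a \<in> U" by blast
  with U(1) obtain s where s: "0 < s" "ball a s \<subseteq> U"
    by (auto simp: open_contains_ball)
  obtain m where m: "\<And>x. x \<in> \<Delta> \<Longrightarrow> dist a x \<le> m"
    using compact_imp_bounded[OF compact_Delta] unfolding bounded_any_center[of _ a] by blast
  from separated_subsets_of_ball_bounded[of "(t + m) / s", where 'a = 'a]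
  obtain C where C: "\<forall>(X :: 'a set) u \<rho>. 0 < \<rho> \<longrightarrow> X \<subseteq> ball u ((t + m) / s * \<rho>) \<longrightarrow>
      (\<forall>x\<in>X. \<forall>y\<in>X. x \<noteq> y \<longrightarrow> \<rho> \<le> dist x y) \<longrightarrow> finite X \<and> card X \<le> C" ..
  have "card {w\<in>words k. comp w k ` \<Delta> \<inter> ball u (t * R k) \<noteq> {}} \<le> C" for k u
  proof -
    let ?W = "{w\<in>words k. comp w k ` \<Delta> \<inter> ball u (t * R k) \<noteq> {}}"
    have sep: "R k * s \<le> dist (comp w k a) (comp v k a)"
      if "w \<in> words k" "v \<in> words k" "w \<noteq> v" for w v
    proof -
      have "comp v k a \<in> comp v k ` U" using \<open>a \<in> U\<close> by simp
      then have "comp v k a \<notin> comp w k ` U"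
        using comp_images_disjoint[OF inv disj that] by blast
      moreover have "ball (comp w k a) (R k * s) \<subseteq> comp w k ` ball a s"
        by (rule ball_subset_similarity_image[OF R_pos dist_comp[OF wordsD[OF that(1)]]])
      ultimately have "comp v k a \<notin> ball (comp w k a) (R k * s)"
        using image_mono[OF s(2), of "comp w k"] by blast
      then show ?thesis by simp
    qed
    have Rs: "0 < R k * s" using s R_pos[of k] by simp
    have inj: "inj_on (\<lambda>w. comp w k a) ?W"
    proof (rule inj_onI, rule ccontr)
      fix w v assume "w \<in> ?W" "v \<in> ?W" "comp w k a = comp v k a" "w \<noteq> v"
      with sep[of w v] Rs show False by simp
    qed
    have sub: "(\<lambda>w. comp w k a) ` ?W \<subseteq> ball u ((t + m) / s * (R k * s))"
    proof (rule image_subsetI)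
      fix w assume w: "w \<in> ?W"
      then obtain x where x: "x \<in> \<Delta>" "dist u (comp w k x) < t * R k" by auto
      have "dist (comp w k x) (comp w k a) = R k * dist a x"
        using w by (subst dist_comp) (auto dest: wordsD simp: dist_commute)
      also have "\<dots> \<le> R k * m"
        using m[OF x(1)] R_pos[of k] by (intro mult_left_mono) auto
      finally have "dist u (comp w k a) < t * R k + R k * m"
        using x(2) dist_triangle[of u "comp w k a" "comp w k x"] by linarith
      also have "t * R k + R k * m = (t + m) / s * (R k * s)"
        using s(1) by (simp add: field_simps)
      finally show "comp w k a \<in> ball u ((t + m) / s * (R k * s))" by simp
    qed
    have "R k * s \<le> dist x y"
      if "x \<in> (\<lambda>w. comp w k a) ` ?W" "y \<in> (\<lambda>w. comp w k a) ` ?W" "x \<noteq> y" for x y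
    proof -
      from that obtain w v where "w \<in> words k" "v \<in> words k" "w \<noteq> v" "x = comp w k a" "y = comp v k a"
        by auto
      then show ?thesis using sep by simp
    qed
    from conjunct2[OF C[rule_format, OF Rs sub this]]
    have "card ((\<lambda>w. comp w k a) ` ?W) \<le> C" by simp
    then show ?thesis by (simp add: card_image[OF inj])
  qed
  then show ?thesis by blast
qed

text \<open>Counting words of one deep level \<open>n\<close> replaces a mass distribution. Every
  cylinder of level \<open>n\<close> meets the attractor and hence one of the balls; ball
  \<open>i\<close> meets at most \<open>C\<close> cylinders of level \<open>k i\<close>, each with
  \<open>P n / P (k i)\<close> descendants. Dividing by \<open>P n\<close> gives the claim.\<close>

lemma sum_inverse_P_ge:
  assumes C: "\<And>k u. card {w\<in>words k. comp w k ` \<Delta> \<inter> ball u (t * R k) \<noteq> {}} \<le> C"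
    and "\<Delta> \<noteq> {}" and I: "finite I" "attractor \<subseteq> (\<Union>i\<in>I. ball (x i) (t * R (k i)))"
  shows "1 \<le> real C * (\<Sum>i\<in>I. 1 / P (k i))"
proof -
  \<comment> \<open>The sum is merely a convenient level at least as deep as every
    \<open>k i\<close>.\<close>
  define n where "n = (\<Sum>i\<in>I. k i)"
  have n: "k i \<le> n" if "i \<in> I" for i
    unfolding n_def using I(1) that by (intro member_le_sum) auto
  let ?A = "\<lambda>i. {w\<in>words (k i). comp w (k i) ` \<Delta> \<inter> ball (x i) (t * R (k i)) \<noteq> {}}"
  let ?W = "\<lambda>i. {w\<in>words n. restrict w {..<k i} \<in> ?A i}"
  have "words n \<subseteq> (\<Union>i\<in>I. ?W i)"
  proof
    fix w assume w: "w \<in> words n"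
    obtain z where z: "z \<in> comp w n ` \<Delta>" "z \<in> attractor"
      using cylinder_meets_attractor[OF w \<open>\<Delta> \<noteq> {}\<close>] by blast
    with I(2) obtain i where i: "i \<in> I" "z \<in> ball (x i) (t * R (k i))" by blast
    have "comp w n ` \<Delta> \<subseteq> comp w (k i) ` \<Delta>"
      using wordsD[OF w] n[OF i(1)] invariant_Delta by (intro comp_image_antimono) auto
    also have "comp w (k i) = comp (restrict w {..<k i}) (k i)"
      by (rule composed_map_cong) simp
    finally have "z \<in> comp (restrict w {..<k i}) (k i) ` \<Delta>" using z(1) by blast
    moreover have "restrict w {..<k i} \<in> words (k i)"
      using wordsD[OF w] n[OF i(1)] by (auto simp: words_def)
    ultimately have "w \<in> ?W i" using i(2) w by blast
    with i(1) show "w \<in> (\<Union>i\<in>I. ?W i)" by blast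
  qed
  then have "card (words n) \<le> card (\<Union>i\<in>I. ?W i)"
    using I(1) finite_words by (intro card_mono) auto
  also have "\<dots> \<le> (\<Sum>i\<in>I. card (?W i))"
    by (rule card_UN_le[OF I(1)])
  finally have "P n \<le> (\<Sum>i\<in>I. real (card (?W i)))"
    unfolding card_words[symmetric] by (simp flip: of_nat_sum)
  also have "\<dots> \<le> (\<Sum>i\<in>I. real C * (P n / P (k i)))"
  proof (rule sum_mono)
    fix i assume i: "i \<in> I"
    have "real (card (?W i)) \<le> real (card (?A i)) * (P n / P (k i))"
      using n[OF i] finite_words by (intro card_words_restrict) auto
    also have "\<dots> \<le> real C * (P n / P (k i))"
      using C[of "k i" "x i"] P_pos[of n] P_pos[of "k i"] by (intro mult_right_mono) auto
    finally show "real (card (?W i)) \<le> real C * (P n / P (k i))" .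
  qed
  also have "\<dots> = P n * (real C * (\<Sum>i\<in>I. 1 / P (k i)))"
    by (simp add: sum_distrib_left algebra_simps)
  finally show ?thesis using P_pos[of n] by simp
qed

text \<open>
  Each covering set \<open>V\<close> is charged to the level \<open>k\<close> at which its diameter lies between
  \<open>diameter \<Delta> * R (Suc k)\<close> and \<open>diameter \<Delta> * R k\<close>. Comparing its cost with level \<open>Suc k\<close> while
  counting cylinders of level \<open>k\<close> makes a doubling condition on the gauge function unnecessary.
\<close>

lemma covering_set_level:
  assumes h: "gauge_function h" and R0: "R \<longlonglongrightarrow> 0" and N_le: "\<And>k. N (\<omega> k) \<le> K"
    and D: "0 < diameter \<Delta>" and M: "0 < M"
    and large: "\<And>k. k0 \<le> k \<Longrightarrow> M \<le> P k * h (diameter \<Delta> * R k)"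
    and P_lim: "filterlim P at_top sequentially"
    and V: "bounded V" "\<And>k. k \<le> k0 \<Longrightarrow> diameter V < diameter \<Delta> * R k" and e: "0 < e"
  shows "\<exists>k x. V \<subseteq> ball x (diameter \<Delta> * R k) \<and> 1 / P k \<le> real K / M * h (diameter V) + e"
proof -
  let ?D = "diameter \<Delta>"
  have sub: "\<exists>x. V \<subseteq> ball x (?D * R k)" if "diameter V < ?D * R k" for k
  proof (cases "V = {}")
    case False
    then obtain x where x: "x \<in> V" by blast
    then have "V \<subseteq> ball x (?D * R k)"
      using diameter_bounded_bound[OF V(1) x] that by (meson le_less_trans mem_ball subsetI)
    then show ?thesis ..
  qed simp
  show ?thesis
  proof (cases "diameter V = 0")
    case True
    \<comment> \<open>A set of diameter zero costs nothing, so the whole charge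
      \<open>1 / P k\<close> has to fit into \<open>e\<close>, which a deep level allows.\<close>
    have "\<forall>\<^sub>F k in sequentially. 1 / e \<le> P k"
      using P_lim unfolding filterlim_at_top by (rule spec)
    then obtain k where "1 / e \<le> P k"
      by (auto simp: eventually_sequentially)
    then have "1 / P k \<le> e" using e P_pos[of k] by (simp add: field_simps)
    moreover obtain x where "V \<subseteq> ball x (?D * R k)"
      using sub[of k] True D R_pos[of k] by auto
    ultimately show ?thesis
      using True by (intro exI[of _ k] exI[of _ x]) (simp add: gauge_zero[OF h])
  next
    case False
    then have pos: "0 < diameter V" using diameter_ge_0[OF V(1)] by simp
    have "(\<lambda>k. ?D * R k) \<longlonglongrightarrow> ?D * 0" by (intro tendsto_intros R0)
    then have "\<forall>\<^sub>F k in sequentially. ?D * R k < diameter V"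
      using pos by (intro order_tendstoD) auto
    then have ex: "\<exists>k. ?D * R k \<le> diameter V"
      by (auto simp: eventually_sequentially intro: less_imp_le)
    \<comment> \<open>The first level whose scale does not exceed the diameter of \<open>V\<close>
      lies beyond \<open>k0\<close> by the smallness of \<open>V\<close>; it therefore has a
      predecessor, and \<open>large\<close> applies to it.\<close>
    define n where "n = (LEAST k. ?D * R k \<le> diameter V)"
    have n: "?D * R n \<le> diameter V" unfolding n_def by (rule LeastI_ex[OF ex])
    have "k0 < n" using V(2)[of n] n by (cases "n \<le> k0") auto
    then obtain k where k: "n = Suc k" by (cases n) auto
    then have lt: "diameter V < ?D * R k"
      using not_less_Least[of k "\<lambda>k. ?D * R k \<le> diameter V"] by (simp add: n_def)
    have "M \<le> P n * h (?D * R n)" using large \<open>k0 < n\<close> by simp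
    also have "\<dots> \<le> P n * h (diameter V)"
      using n D R_pos[of n] P_pos[of n] by (intro mult_left_mono gauge_mono[OF h]) auto
    also have "\<dots> \<le> (P k * real K) * h (diameter V)"
      unfolding k using N_le[of k] P_pos[of k] pos
      by (intro mult_right_mono gauge_nonneg[OF h]) (auto simp: P_def)
    finally have "1 / P k \<le> real K / M * h (diameter V)"
      using P_pos[of k] M by (simp add: field_simps)
    with e sub[OF lt] show ?thesis by (intro exI[of _ k]) auto
  qed
qed

text \<open>For each \<open>B\<close> a sufficiently fine cover costs at least \<open>B\<close>: its
  sets are charged to levels by \<open>covering_set_level\<close>, and
  \<open>sum_inverse_P_ge\<close> bounds the total charge from below.\<close>

lemma hausdorff_measure_infty:
  assumes U: "open U" "U \<noteq> {}"
    and inv: "\<And>i l. i \<in> {1..N (\<omega> l)} \<Longrightarrow> f (\<omega> l) i ` U \<subseteq> U"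
    and disj: "\<And>l i i'. i \<in> {1..N (\<omega> l)} \<Longrightarrow> i' \<in> {1..N (\<omega> l)} \<Longrightarrow> i \<noteq> i' \<Longrightarrow>
       f (\<omega> l) i ` U \<inter> f (\<omega> l) i' ` U = {}"
    and h: "gauge_function h" and R0: "R \<longlonglongrightarrow> 0" and N_le: "\<And>k. N (\<omega> k) \<le> K"
    and liminf: "liminf (\<lambda>k. ereal (P k * h (diameter \<Delta> * R k))) = \<infinity>"
  shows "hausdorff_measure h attractor = \<infinity>"
proof -
  let ?D = "diameter \<Delta>"
  obtain C where C: "\<And>k u. card {w\<in>words k. comp w k ` \<Delta> \<inter> ball u (?D * R k) \<noteq> {}} \<le> C"
    using cylinders_meeting_ball[OF U inv disj, of ?D] by blast
  have ev: "\<forall>\<^sub>F k in sequentially. b < P k * h (?D * R k)" for b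
    using less_LiminfD[of "ereal b" sequentially "\<lambda>k. ereal (P k * h (?D * R k))"] liminf by simp
  have D: "0 < ?D"
  proof (rule ccontr)
    assume "\<not> 0 < ?D"
    then have "?D = 0" using diameter_ge_0[OF compact_imp_bounded[OF compact_Delta]] by simp
    then show False using ev[of 0] by (simp add: gauge_zero[OF h])
  qed
  then have ne: "\<Delta> \<noteq> {}" by auto
  have K: "0 < K" using N_pos[of 0] N_le[of 0] by simp
  \<comment> \<open>Eventually \<open>R k < 1\<close>, so the gauge factor is at most
    \<open>h ?D\<close> and the divergence must come from \<open>P k\<close>.\<close>
  have P_lim: "filterlim P at_top sequentially"
    unfolding filterlim_at_top
  proof
    fix b :: real
    have "\<forall>\<^sub>F k in sequentially. ?D * R k < ?D"
      using order_tendstoD(2)[OF R0, of 1] D by (auto elim: eventually_mono)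
    with ev[of "\<bar>b\<bar> * h ?D"] show "\<forall>\<^sub>F k in sequentially. b \<le> P k"
    proof eventually_elim
      case (elim k)
      have "P k * h (?D * R k) \<le> P k * h ?D"
        using elim(2) P_pos[of k] R_pos[of k] D by (intro mult_left_mono gauge_mono[OF h]) auto
      with elim(1) have "\<bar>b\<bar> * h ?D < P k * h ?D" by simp
      then have "\<bar>b\<bar> < P k"
        by (rule mult_right_less_imp_less) (use gauge_nonneg[OF h, of ?D] D in simp)
      then show ?case by simp
    qed
  qed
  have real_le: "ennreal B \<le> hausdorff_measure h attractor" if B: "0 < B" for B
  proof -
    \<comment> \<open>\<open>M\<close> is tuned so that, with total error
      \<open>1 / (2 * (real C + 1))\<close>, the final inequality reads
      \<open>1 \<le> ?H / (2 * B) + 1 / 2\<close>. Using \<open>C + 1\<close> avoids division by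
      zero.\<close>
    define M where "M = 2 * (real C + 1) * real K * B"
    have M: "0 < M" using B K by (simp add: M_def)
    obtain k0 where k0: "\<And>k. k0 \<le> k \<Longrightarrow> M \<le> P k * h (?D * R k)"
      using ev[of M] by (auto simp: eventually_sequentially intro: less_imp_le)
    \<comment> \<open>Half of the smallest scale up to level \<open>k0\<close> makes every covering
      set strictly smaller than those scales.\<close>
    define \<delta> where "\<delta> = Min ((\<lambda>k. ?D * R k) ` {..k0}) / 2"
    have \<delta>: "0 < \<delta>" using D R_pos by (simp add: \<delta>_def)
    have small: "d < ?D * R k" if "d \<le> \<delta>" "k \<le> k0" for d k
    proof -
      have "Min ((\<lambda>k. ?D * R k) ` {..k0}) \<le> ?D * R k"
        using that(2) by (intro Min_le) auto
      then have "2 * \<delta> \<le> ?D * R k" unfolding \<delta>_def by simp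
      with \<delta> that(1) show ?thesis by linarith
    qed
    have "ennreal B \<le> hausdorff_pre h \<delta> attractor"
      unfolding hausdorff_pre_def
    proof (rule INF_greatest)
      fix V assume "V \<in> {V :: nat \<Rightarrow> 'a set. (\<forall>i. bounded (V i) \<and> diameter (V i) \<le> \<delta>) \<and>
        attractor \<subseteq> (\<Union>i. V i)}"
      then have V: "\<And>i. bounded (V i)" "\<And>i. diameter (V i) \<le> \<delta>" "attractor \<subseteq> (\<Union>i. V i)" by auto
      define e where "e i = (1 / (2 * (real C + 1))) * (1 / 2) ^ Suc i" for i :: nat
      have e: "0 < e i" for i by (simp add: e_def)
      have "\<exists>k x. V i \<subseteq> ball x (?D * R k) \<and> 1 / P k \<le> real K / M * h (diameter (V i)) + e i" for i
        by (rule covering_set_level[OF h R0 N_le D M k0 P_lim V(1) small[OF V(2)] e])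
      then obtain k x where kx: "\<And>i. V i \<subseteq> ball (x i) (?D * R (k i))"
        "\<And>i. 1 / P (k i) \<le> real K / M * h (diameter (V i)) + e i" by metis
      have "attractor \<subseteq> (\<Union>i. ball (x i) (?D * R (k i)))"
        using V(3) kx(1) by blast
      \<comment> \<open>The enclosing balls are open and the attractor is compact, so finitely many
        levels remain and can be compared at one depth.\<close>
      then obtain I where I: "finite I" "attractor \<subseteq> (\<Union>i\<in>I. ball (x i) (?D * R (k i)))"
        using compactE_image[OF compact_attractor, of UNIV "\<lambda>i. ball (x i) (?D * R (k i))"]
        by auto
      let ?H = "\<Sum>i\<in>I. h (diameter (V i))"
      have "e sums (1 / (2 * (real C + 1)) * 1)"
        unfolding e_def by (intro sums_mult power_half_series)
      then have "(\<Sum>i\<in>I. e i) \<le> 1 / (2 * (real C + 1))"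
        using sum_le_suminf[of e I] e I(1) by (auto simp: sums_iff intro: less_imp_le)
      then have "(\<Sum>i\<in>I. 1 / P (k i)) \<le> real K / M * ?H + 1 / (2 * (real C + 1))"
        using sum_mono[of I "\<lambda>i. 1 / P (k i)", OF kx(2)]
        by (simp add: sum.distrib sum_distrib_left)
      moreover have "1 \<le> (real C + 1) * (\<Sum>i\<in>I. 1 / P (k i))"
      proof -
        have "0 \<le> (\<Sum>i\<in>I. 1 / P (k i))"
          using P_pos by (intro sum_nonneg) (simp add: less_imp_le)
        with sum_inverse_P_ge[OF C ne I] show ?thesis by (simp add: algebra_simps)
      qed
      ultimately have "1 \<le> (real C + 1) * (real K / M * ?H + 1 / (2 * (real C + 1)))"
        by (meson mult_left_mono of_nat_0_le_iff add_nonneg_nonneg zero_le_one order_trans)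
      also have "\<dots> = (real C + 1) * (real K / M * ?H) + 1 / 2"
        by (simp add: field_simps)
      also have "(real C + 1) * (real K / M * ?H) = ?H / (2 * B)"
      proof -
        have "M = (real C + 1) * real K * (2 * B)" by (simp add: M_def)
        moreover have "real C + 1 \<noteq> 0" by linarith
        ultimately show ?thesis using K by simp
      qed
      finally have "B \<le> ?H" using B by (simp add: field_simps)
      then have "ennreal B \<le> ennreal ?H" by (rule ennreal_leI)
      also have "\<dots> = (\<Sum>i\<in>I. ennreal (h (diameter (V i))))"
        using diameter_ge_0[OF V(1)] by (intro sum_ennreal[symmetric] gauge_nonneg[OF h])
      also have "\<dots> \<le> (\<Sum>i. ennreal (h (diameter (V i))))"
        using I(1) by (intro sum_le_suminf) auto
      finally show "ennreal B \<le> (\<Sum>i. ennreal (h (diameter (V i))))" .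
    qed
    also have "\<dots> \<le> hausdorff_measure h attractor"
      unfolding hausdorff_measure_eq_SUP using \<delta> by (intro SUP_upper) simp
    finally show ?thesis .
  qed
  have "of_nat n \<le> hausdorff_measure h attractor" for n
    using real_le[of "real n"] by (cases "n = 0") (simp_all add: ennreal_of_nat_eq_real_of_nat)
  then have "(SUP n. of_nat n :: ennreal) \<le> hausdorff_measure h attractor"
    by (intro SUP_least)
  then show ?thesis by (simp add: ennreal_SUP_of_nat_eq_top top_unique)
qed

end

section \<open>Random homogeneous attractors\<close>

lemma equicontractiveD:
  assumes "equicontractive \<Lambda> N c" "l \<in> \<Lambda>" "i \<in> {1..N l}" "j \<in> {1..N l}"
  shows "c l i = c l j"
proof -
  from assms(1,2) obtain r where "\<forall>i\<in>{1..N l}. c l i = r"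
    unfolding equicontractive_def by blast
  with assms(3,4) show ?thesis by simp
qed

text \<open>Equicontractivity turns the sum of the powers of the ratios into
  \<open>real (N l) * c l 1 powr s\<close>, so failing to be almost deterministic is the hypothesis
  of \<open>gauge_liminf_zero_infty\<close>.\<close>

lemma gauge_liminf_zero_infty_iid:
  assumes rifs: "random_ifs \<mu> \<Lambda> N f c \<Delta>"
    and c_bounds: "0 < cmin" "cmax < 1"
      "\<And>l i. l \<in> \<Lambda> \<Longrightarrow> i \<in> {1..N l} \<Longrightarrow> cmin \<le> c l i \<and> c l i \<le> cmax"
    and equi: "equicontractive \<Lambda> N c"
    and not_det: "\<not> almost_deterministic \<mu> N c"
    and h: "gauge_function h" and D: "0 < D"
  shows "AE \<omega> in homogeneous_measure \<mu>.
    liminf (\<lambda>k. ereal ((\<Prod>i<k. real (N (\<omega> i))) * h (D * (\<Prod>i<k. c (\<omega> i) 1)))) \<in> {0, \<infinity>}"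
proof -
  interpret random_ifs \<mu> \<Lambda> N f c \<Delta> by (rule rifs)
  interpret S: sequence_space \<mu> by unfold_locales
  \<comment> \<open>The law for i.i.d. products is stated for a gauge monotone on the whole line,
    whereas \<open>h\<close> is controlled only on \<open>{0..}\<close>.\<close>
  define h' where "h' x = h (max 0 x)" for x
  have one: "1 \<in> {1..N l}" if "l \<in> \<Lambda>" for l using N_ge_1[OF that] by simp
  \<comment> \<open>The first ratio is measurable on the set where a first map exists, which is the
    whole space.\<close>
  have "{l \<in> \<Lambda>. 1 \<le> N l} = space \<mu>"
    using N_ge_1 by (auto simp: space_param)
  moreover have "sets (restrict_space \<mu> (space \<mu>)) = sets \<mu>"
    using sets.Int_space_eq1[of _ \<mu>] by (force simp: sets_restrict_space image_iff)
  ultimately have c_meas: "(\<lambda>l. c l 1) \<in> borel_measurable \<mu>"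
    using measurable_c[of 1] by (simp cong: measurable_cong_sets)
  have N_meas: "(\<lambda>l. real (N l)) \<in> borel_measurable \<mu>"
    using measurable_N by measurable
  have nondet: "\<not> (\<exists>s. AE l in \<mu>. real (N l) * c l 1 powr s = 1)"
  proof
    assume "\<exists>s. AE l in \<mu>. real (N l) * c l 1 powr s = 1"
    then obtain s where "AE l in \<mu>. real (N l) * c l 1 powr s = 1" ..
    then have "AE l in \<mu>. (\<Sum>j=1..N l. c l j powr s) = 1"
      using AE_space
    proof eventually_elim
      case (elim l)
      then have l: "l \<in> \<Lambda>" by (simp add: space_param)
      have "c l j powr s = c l 1 powr s" if "j \<in> {1..N l}" for j
        using equicontractiveD[OF equi l that one[OF l]] by (rule arg_cong)
      then have "(\<Sum>j=1..N l. c l j powr s) = (\<Sum>j=1..N l. c l 1 powr s)"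
        by (rule sum.cong[OF refl])
      with elim(1) show ?case by simp
    qed
    with not_det show False unfolding almost_deterministic_def by blast
  qed
  have "AE \<omega> in S.S. gauge_liminf (\<lambda>l. real (N l)) (\<lambda>l. c l 1) h' D \<omega> \<in> {0, \<infinity>}"
  proof (rule S.gauge_liminf_zero_infty[OF N_meas c_meas _ _ c_bounds(1,2) _ _ nondet D])
    show "mono h'"
      unfolding h'_def by (intro monoI gauge_mono[OF h]) auto
    show "0 \<le> h' x" for x
      unfolding h'_def by (intro gauge_nonneg[OF h]) simp
  qed (use N_ge_1 c_bounds(3) one in \<open>auto simp: space_param Suc_le_eq\<close>)
  moreover have "AE \<omega> in S.S. \<omega> \<in> space S.S" by (rule AE_space)
  ultimately show ?thesis
    unfolding homogeneous_measure_def
  proof eventually_elim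
    case (elim \<omega>)
    then have "\<omega> i \<in> \<Lambda>" for i by (auto simp: space_PiM space_param)
    then have "0 \<le> c (\<omega> i) 1" for i using ratio[OF _ one] by (simp add: less_imp_le)
    then have "0 \<le> D * (\<Prod>i<k. c (\<omega> i) 1)" for k
      using D by (intro mult_nonneg_nonneg prod_nonneg) auto
    then show ?case
      using elim(1) unfolding gauge_liminf_def h'_def by (simp add: max_absorb2)
  qed
qed

theorem theorem4p2:
  fixes \<Lambda> :: "(real ^ 'k) set"
    and \<mu> :: "(real ^ 'k) measure"
    and N :: "real ^ 'k \<Rightarrow> nat"
    and f :: "real ^ 'k \<Rightarrow> nat \<Rightarrow> real ^ 'd \<Rightarrow> real ^ 'd"
    and c :: "real ^ 'k \<Rightarrow> nat \<Rightarrow> real"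
    and \<Delta> :: "(real ^ 'd) set"
    and cmin cmax :: real
  assumes rifs: "random_ifs \<mu> \<Lambda> N f c \<Delta>"
    and uosc: "uniform_osc \<Lambda> N f"
    and N_bounds: "bdd_above (N ` \<Lambda>)" "2 \<le> (SUP l\<in>\<Lambda>. N l)"
    and c_bounds: "0 < cmin" "cmax < 1"
      "\<And>l i. l \<in> \<Lambda> \<Longrightarrow> i \<in> {1..N l} \<Longrightarrow> cmin \<le> c l i \<and> c l i \<le> cmax"
    and log_N: "0 < (\<integral>\<omega>. ln (real (N (\<omega> 0))) \<partial>homogeneous_measure \<mu>)"
    and equi: "equicontractive \<Lambda> N c"
    and not_det: "\<not> almost_deterministic \<mu> N c"
  shows "(\<forall>h. gauge_function h \<longrightarrow>
            (AE \<omega> in homogeneous_measure \<mu>.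
               hausdorff_measure h (homogeneous_attractor N f \<Delta> \<omega>) \<in> {0, \<infinity>})) \<and>
         \<not> (\<exists>h. gauge_function h \<and>
            (AE \<omega> in homogeneous_measure \<mu>.
               0 < hausdorff_measure h (homogeneous_attractor N f \<Delta> \<omega>) \<and>
               hausdorff_measure h (homogeneous_attractor N f \<Delta> \<omega>) < \<infinity>))"
proof -
  interpret random_ifs \<mu> \<Lambda> N f c \<Delta> by (rule rifs)
  interpret H: prob_space "homogeneous_measure \<mu>"
    unfolding homogeneous_measure_def by (rule prob_space_PiM) (rule prob_space_axioms)
  obtain K where K: "\<And>l. l \<in> \<Lambda> \<Longrightarrow> N l \<le> K"
    using N_bounds(1) by (auto simp: bdd_above_def)
  obtain U where "open U" "U \<noteq> {}" and "\<forall>l\<in>\<Lambda>. \<forall>i\<in>{1..N l}. f l i ` U \<subseteq> U"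
    and "\<forall>l\<in>\<Lambda>. \<forall>i\<in>{1..N l}. \<forall>j\<in>{1..N l}. i \<noteq> j \<longrightarrow> f l i ` U \<inter> f l j ` U = {}"
    using uosc unfolding uniform_osc_def by (elim exE conjE) (rule that)
  then have U: "open U" "U \<noteq> {}"
    "l \<in> \<Lambda> \<Longrightarrow> i \<in> {1..N l} \<Longrightarrow> f l i ` U \<subseteq> U"
    "l \<in> \<Lambda> \<Longrightarrow> i \<in> {1..N l} \<Longrightarrow> j \<in> {1..N l} \<Longrightarrow> i \<noteq> j \<Longrightarrow> f l i ` U \<inter> f l j ` U = {}"
    for l i j
    by blast+
  let ?D = "diameter \<Delta>"
  let ?H = "\<lambda>h \<omega>. hausdorff_measure h (homogeneous_attractor N f \<Delta> \<omega>)"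
  have one: "1 \<in> {1..N l}" if "l \<in> \<Lambda>" for l using N_ge_1[OF that] by simp
  have main: "AE \<omega> in homogeneous_measure \<mu>. ?H h \<omega> \<in> {0, \<infinity>}" if h: "gauge_function h" for h
  proof -
    have "AE \<omega> in homogeneous_measure \<mu>.
      liminf (\<lambda>k. ereal ((\<Prod>i<k. real (N (\<omega> i))) * h (?D * (\<Prod>i<k. c (\<omega> i) 1)))) \<in> {0, \<infinity>}"
    \<comment> \<open>If \<open>\<Delta>\<close> has diameter zero, every term contains
      \<open>h 0 = 0\<close> and the lower limit is \<open>0\<close>.\<close>
    proof (cases "0 < ?D")
      case True
      show ?thesis by (rule gauge_liminf_zero_infty_iid[OF rifs c_bounds equi not_det h True])
    next
      case False
      then have "?D = 0" using diameter_ge_0[OF compact_imp_bounded[OF compact_Delta]] by simp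
      then show ?thesis by (simp add: gauge_zero[OF h] Liminf_const flip: zero_ereal_def)
    qed
    then show ?thesis
      using AE_space
    proof eventually_elim
      case (elim \<omega>)
      then have \<omega>: "\<omega> k \<in> \<Lambda>" for k
        by (auto simp: homogeneous_measure_def space_PiM space_param)
      \<comment> \<open>The ratio of the first map, which exists at every step, serves as the common
        ratio.\<close>
      interpret G: nonautonomous_ifs N f \<Delta> \<omega> "\<lambda>k. c (\<omega> k) 1"
      proof
        fix i k x y assume i: "i \<in> {1..N (\<omega> k)}"
        have "c (\<omega> k) i = c (\<omega> k) 1"
          by (rule equicontractiveD[OF equi \<omega> i one[OF \<omega>]])
        then show "dist (f (\<omega> k) i x) (f (\<omega> k) i y) = c (\<omega> k) 1 * dist x y"
          using similarity[OF \<omega> i] by simp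
        show "f (\<omega> k) i ` \<Delta> \<subseteq> \<Delta>" by (rule invariant_Delta[OF \<omega> i])
      qed (use N_ge_1 \<omega> ratio[OF \<omega> one[OF \<omega>]] compact_Delta in auto)
      have R0: "G.R \<longlonglongrightarrow> 0"
      proof (rule tendsto_sandwich[where f = "\<lambda>_. 0" and h = "\<lambda>k. cmax ^ k"])
        have c: "0 \<le> c (\<omega> k) 1" "c (\<omega> k) 1 \<le> cmax" for k
          using ratio[OF \<omega> one[OF \<omega>], of k] c_bounds(3)[OF \<omega> one[OF \<omega>], of k] by auto
        then have "0 \<le> cmax" using order_trans by blast
        then show "(\<lambda>k. cmax ^ k) \<longlonglongrightarrow> 0"
          using c_bounds(2) by (intro LIMSEQ_power_zero) simp
        have "G.R k \<le> (\<Prod>i<k. cmax)" for k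
          unfolding G.R_def using c by (intro prod_mono) auto
        then show "\<forall>\<^sub>F k in sequentially. G.R k \<le> cmax ^ k" by simp
        show "\<forall>\<^sub>F k in sequentially. 0 \<le> G.R k"
          using G.R_pos by (simp add: less_imp_le)
      qed simp
      from elim(1) consider
          "liminf (\<lambda>k. ereal (G.P k * h (?D * G.R k))) = 0"
        | "liminf (\<lambda>k. ereal (G.P k * h (?D * G.R k))) = \<infinity>"
        unfolding G.P_def G.R_def by blast
      then show ?case
      proof cases
        case 1
        then show ?thesis using G.hausdorff_measure_zero[OF h R0] by simp
      next
        case 2
        have "?H h \<omega> = \<infinity>"
          by (rule G.hausdorff_measure_infty[OF U(1,2) U(3)[OF \<omega>] U(4)[OF \<omega>] h R0 K[OF \<omega>] 2])
        then show ?thesis by simp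
      qed
    qed
  qed
  \<comment> \<open>Together with \<open>main\<close> this would make \<open>False\<close> hold
    almost surely, which is impossible for a probability measure.\<close>
  have "\<not> (AE \<omega> in homogeneous_measure \<mu>. 0 < ?H h \<omega> \<and> ?H h \<omega> < \<infinity>)" if "gauge_function h" for h
  proof
    assume "AE \<omega> in homogeneous_measure \<mu>. 0 < ?H h \<omega> \<and> ?H h \<omega> < \<infinity>"
    with main[OF that] have "AE \<omega> in homogeneous_measure \<mu>. False"
      by eventually_elim auto
    then show False by simp
  qed
  with main show ?thesis by blast
qed

end
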